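(* Let $2\le k\le n$ and let $\Omega\subset\mathbb R^n$ be a bounded smooth uniformly convex domain. Fix $E\in\mathrm{Gr}(k-1,n)$, set $V=E^\perp$, $\phi_E(x)=\frac12|P_Ex|^2$, and let $f\in C^\infty(\overline\Omega)$ satisfy $f\ge c_0>0$. For each $t>0$ let $u_{t,E}^f\in C^\infty(\overline\Omega)$ be the unique smooth $k$-admissible solution of $$\sigma_k(D^2u_{t,E}^f)=f\ \text{ in }\Omega,\qquad u_{t,E}^f=t\phi_E\ \text{ on }\partial\Omega,$$ and let $U_{t,E}^f=t\phi_E+t^{1-k}w_E^f$. Then $U_{t,E}^f\in C^\infty(\overline\Omega)$ and $U_{t,E}^f=t\phi_E$ on $\partial\Omega$; in particular $u_{t,E}^f-U_{t,E}^f\in C^\infty(\overline\Omega)$. There are constants $C>0$ and $t_0>0$, depending on $E$, $f$, $\Omega$ and $k$ but not on $t$, such that $$\big\|u_{t,E}^f-U_{t,E}^f\big\|_{L^\infty(\Omega)}\le C\,t^{1-2k}\qquad\text{for }t\ge t_0 .$$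
   Context: For a symmetric matrix $M$, $\sigma_j(M)$ is the $j$-th elementary symmetric function of its eigenvalues; $\Gamma_k=\{\lambda\in\mathbb R^n:\sigma_j(\lambda)>0,\ 1\le j\le k\}$; a $C^2$ function $u$ is $k$-admissible if the eigenvalues of $D^2u(x)$ lie in $\Gamma_k$ for all $x\in\Omega$. Existence and uniqueness of $u_{t,E}^f$ is due to Caffarelli–Nirenberg–Spruck. Uniformly convex means that all principal curvatures of $\partial\Omega$ are bounded below by a positive constant. $\mathrm{Gr}(m,n)$ is the Grassmannian of $m$-dimensional linear subspaces; $P_E,P_V$ are orthogonal projections. The fiberwise Poisson correction $w_E^f$ is defined on each section $\Omega\cap(y+V)$, $y\in P_E(\Omega)$, as the solution of $\Delta_Vw_E^f=f$ in $\Omega\cap(y+V)$, $w_E^f=0$ on the boundary of this section in $y+V$, where $\Delta_Vu=\mathrm{tr}(P_VD^2u)$ is the Laplacian in the $V$ directions; these solutions together form a function $w_E^f\in C^\infty(\overline\Omega)$ with $\Delta_Vw_E^f=f$ in $\Omega$ and $w_E^f=0$ on $\partial\Omega$. *)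

theory Defs
  imports "HOL-Analysis.Analysis" "HOL-Probability.Essential_Supremum"
begin

definition partial_deriv :: "'n::finite \<Rightarrow> (real^'n \<Rightarrow> real) \<Rightarrow> real^'n \<Rightarrow> real" where
  "partial_deriv i g = (\<lambda>x. frechet_derivative g (at x) (axis i 1))"

fun iter_partial :: "'n::finite list \<Rightarrow> (real^'n \<Rightarrow> real) \<Rightarrow> real^'n \<Rightarrow> real" where
  "iter_partial [] g = g"
| "iter_partial (i # ds) g = partial_deriv i (iter_partial ds g)"

text \<open>For open \<open>W\<close> this is \<open>C\<^sup>\<infinity>(W)\<close>: differentiability of all iterated
  partial derivatives makes each of them continuous.\<close>

definition smooth_on_open :: "(real^'n::finite) set \<Rightarrow> (real^'n \<Rightarrow> real) \<Rightarrow> bool" where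
  "smooth_on_open W g \<longleftrightarrow> (\<forall>ds. \<forall>x\<in>W. iter_partial ds g differentiable (at x))"

text \<open>The space \<open>C\<^sup>\<infinity>\<close> of the closure of an open set: smooth inside, with every partial
  derivative extending continuously to the closure. The values of \<open>g\<close> itself on the
  boundary are required to be the continuous ones; values outside the closure are irrelevant.\<close>

definition smooth_up_to_boundary :: "(real^'n::finite) set \<Rightarrow> (real^'n \<Rightarrow> real) \<Rightarrow> bool" where
  "smooth_up_to_boundary \<Omega> g \<longleftrightarrow>
     smooth_on_open \<Omega> g \<and> continuous_on (closure \<Omega>) g \<and>
     (\<forall>ds. \<exists>h. continuous_on (closure \<Omega>) h \<and> (\<forall>x\<in>\<Omega>. h x = iter_partial ds g x))"

definition grad :: "(real^'n::finite \<Rightarrow> real) \<Rightarrow> real^'n \<Rightarrow> real^'n" where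
  "grad g x = (\<chi> i. partial_deriv i g x)"

definition hessian :: "(real^'n::finite \<Rightarrow> real) \<Rightarrow> real^'n \<Rightarrow> real^'n^'n" where
  "hessian g x = (\<chi> i j. iter_partial [i, j] g x)"


definition local_defining_function ::
  "(real^'n::finite) set \<Rightarrow> real^'n \<Rightarrow> (real^'n) set \<Rightarrow> (real^'n \<Rightarrow> real) \<Rightarrow> bool" where
  "local_defining_function \<Omega> p W \<rho> \<longleftrightarrow>
     open W \<and> p \<in> W \<and> smooth_on_open W \<rho> \<and> (\<forall>x\<in>W. grad \<rho> x \<noteq> 0) \<and>
     \<Omega> \<inter> W = {x\<in>W. \<rho> x < 0} \<and> frontier \<Omega> \<inter> W = {x\<in>W. \<rho> x = 0}"

definition smooth_domain :: "(real^'n::finite) set \<Rightarrow> bool" where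
  "smooth_domain \<Omega> \<longleftrightarrow>
     open \<Omega> \<and> connected \<Omega> \<and> \<Omega> \<noteq> {} \<and>
     (\<forall>p\<in>frontier \<Omega>. \<exists>W \<rho>. local_defining_function \<Omega> p W \<rho>)"

text \<open>The principal curvatures at \<open>p\<close> are the eigenvalues of the Weingarten map \<open>v \<mapsto> D\<nu>(p) v\<close> on the
  tangent space, where \<open>\<nu> = grad \<rho> / |grad \<rho>|\<close> extends the outward unit normal. Only tangential
  derivatives of \<open>\<nu>\<close> enter, so the notion does not depend on \<open>\<rho>\<close>; with this sign the
  sphere of radius \<open>r\<close>, as the boundary of the ball, has all principal curvatures \<open>1/r\<close>.\<close>

definition principal_curvature :: "(real^'n::finite) set \<Rightarrow> real^'n \<Rightarrow> real \<Rightarrow> bool" where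
  "principal_curvature \<Omega> p \<kappa> \<longleftrightarrow>
     (\<exists>W \<rho> v. local_defining_function \<Omega> p W \<rho> \<and> v \<noteq> 0 \<and> v \<bullet> grad \<rho> p = 0 \<and>
        frechet_derivative (\<lambda>x. grad \<rho> x /\<^sub>R norm (grad \<rho> x)) (at p) v = \<kappa> *\<^sub>R v)"

definition uniformly_convex :: "(real^'n::finite) set \<Rightarrow> bool" where
  "uniformly_convex \<Omega> \<longleftrightarrow>
     (\<exists>\<kappa>\<^sub>0>0. \<forall>p\<in>frontier \<Omega>. \<forall>\<kappa>. principal_curvature \<Omega> p \<kappa> \<longrightarrow> \<kappa>\<^sub>0 \<le> \<kappa>)"


definition elem_sym :: "nat \<Rightarrow> real^'n::finite \<Rightarrow> real" where
  "elem_sym j l = (\<Sum>S | S \<subseteq> (UNIV :: 'n set) \<and> card S = j. \<Prod>i\<in>S. l $ i)"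

definition Garding_cone :: "nat \<Rightarrow> (real^'n::finite) set" where
  "Garding_cone k = {l. \<forall>j. 1 \<le> j \<and> j \<le> k \<longrightarrow> elem_sym j l > 0}"

text \<open>The vector of eigenvalues, repeated according to multiplicity as roots of the characteristic
  polynomial. For symmetric \<open>M\<close> it exists and is unique up to the order of its entries, which
  is immaterial below since it is only used in symmetric expressions.\<close>

definition eigenvalues :: "real^'n^'n::finite \<Rightarrow> real^'n" where
  "eigenvalues M = (SOME l. \<forall>x. det (mat x - M) = (\<Prod>i\<in>UNIV. x - l $ i))"

definition sigma :: "nat \<Rightarrow> real^'n^'n::finite \<Rightarrow> real" where
  "sigma j M = elem_sym j (eigenvalues M)"

definition admissible :: "nat \<Rightarrow> (real^'n::finite) set \<Rightarrow> (real^'n \<Rightarrow> real) \<Rightarrow> bool" where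
  "admissible k \<Omega> u \<longleftrightarrow> (\<forall>x\<in>\<Omega>. eigenvalues (hessian u x) \<in> Garding_cone k)"


definition Grassmannian :: "nat \<Rightarrow> (real^'n::finite) set set" where
  "Grassmannian m = {E. subspace E \<and> dim E = m}"

definition orth_proj :: "(real^'n::finite) set \<Rightarrow> real^'n \<Rightarrow> real^'n" where
  "orth_proj E x = (THE p. p \<in> E \<and> x - p \<in> E\<^sup>\<bottom>)"

definition \<phi> :: "(real^'n::finite) set \<Rightarrow> real^'n \<Rightarrow> real" where
  "\<phi> E x = (norm (orth_proj E x))\<^sup>2 / 2"

definition laplacian_along :: "(real^'n::finite) set \<Rightarrow> (real^'n \<Rightarrow> real) \<Rightarrow> real^'n \<Rightarrow> real" where
  "laplacian_along V u x = trace (matrix (orth_proj V) ** hessian u x)"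

text \<open>On each section of \<open>\<Omega>\<close> by \<open>y + V\<close>, \<open>w\<close> solves the Poisson problem with zero values on the
  boundary of the section relative to \<open>y + V\<close>, and these solutions fit together to a function
  that is smooth up to the boundary of \<open>\<Omega>\<close> and vanishes there. The last clause matters at the
  boundary points of \<open>\<Omega>\<close> whose projection to \<open>E\<close> lies on the boundary of the projection of \<open>\<Omega>\<close>:
  they belong to no closed section.\<close>

definition fiberwise_poisson_correction ::
  "(real^'n::finite) set \<Rightarrow> (real^'n) set \<Rightarrow> (real^'n \<Rightarrow> real) \<Rightarrow> (real^'n \<Rightarrow> real) \<Rightarrow> bool" where
  "fiberwise_poisson_correction \<Omega> E f w \<longleftrightarrow>
     smooth_up_to_boundary \<Omega> w \<and>
     (\<forall>y\<in>orth_proj E ` \<Omega>.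
        let V = E\<^sup>\<bottom>; A = (+) y ` V in
        (\<forall>x\<in>\<Omega> \<inter> A. laplacian_along V w x = f x) \<and>
        (\<forall>x\<in>top_of_set A frontier_of (\<Omega> \<inter> A). w x = 0)) \<and>
     (\<forall>x\<in>frontier \<Omega>. w x = 0)"

definition admissible_solution ::
  "nat \<Rightarrow> (real^'n::finite) set \<Rightarrow> (real^'n \<Rightarrow> real) \<Rightarrow> (real^'n \<Rightarrow> real) \<Rightarrow> (real^'n \<Rightarrow> real) \<Rightarrow> bool"
  where
  "admissible_solution k \<Omega> f g u \<longleftrightarrow>
     smooth_up_to_boundary \<Omega> u \<and> admissible k \<Omega> u \<and>
     (\<forall>x\<in>\<Omega>. sigma k (hessian u x) = f x) \<and> (\<forall>x\<in>frontier \<Omega>. u x = g x)"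

definition approx_solution ::
  "nat \<Rightarrow> (real^'n::finite) set \<Rightarrow> (real^'n \<Rightarrow> real) \<Rightarrow> real \<Rightarrow> real^'n \<Rightarrow> real" where
  "approx_solution k E w t x = t * \<phi> E x + t powi (1 - int k) * w x"

definition Linfty_norm :: "(real^'n::finite) set \<Rightarrow> (real^'n \<Rightarrow> real) \<Rightarrow> ereal" where
  "Linfty_norm \<Omega> g = esssup (restrict_space lebesgue \<Omega>) (\<lambda>x. ereal \<bar>g x\<bar>)"

end

theory Submission
  imports Defs "HOL-Computational_Algebra.Fundamental_Theorem_Algebra"
begin

text \<open>
  Since \<open>\<Delta>\<^sub>V w = f > 0\<close> and \<open>w = 0\<close> on the boundary, the correction \<open>w\<close> serves as its own barrier
  function. With \<open>P = D\<^sup>2 \<phi>\<^sub>E\<close>, a projection of rank \<open>k - 1\<close>, one has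
  \<open>\<sigma>\<^sub>k(P + \<epsilon> M) = \<epsilon> tr(P\<^sub>V M) + O(\<epsilon>\<^sup>2)\<close>. For \<open>\<epsilon> = t\<^sup>-\<^sup>k\<close> and
  \<open>W\<^sub>\<theta> = t \<phi>\<^sub>E + \<theta> t\<^sup>1\<^sup>-\<^sup>k w\<close> this gives, after scaling by \<open>t\<close>,
  \<open>\<sigma>\<^sub>k(D\<^sup>2 W\<^sub>\<theta>) = \<theta> f + O(\<epsilon>)\<close> uniformly in \<open>0 \<le> \<theta> \<le> 2\<close>, so that for a large
  constant \<open>A\<close> the functions with \<open>\<theta> = 1 \<plusminus> A \<epsilon>\<close> are a strict sub- and a strict supersolution with
  the same boundary values as \<open>u\<close>. The comparison principle yields
  \<open>\<bar>u - U\<bar> \<le> A \<epsilon> t\<^sup>1\<^sup>-\<^sup>k \<bar>w\<bar> = O(t\<^sup>1\<^sup>-\<^sup>2\<^sup>k)\<close>.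

  Comparison rests on the monotonicity of \<open>\<sigma>\<^sub>k\<close> on the Garding cone. Along \<open>A + \<tau> N\<close> with \<open>N \<ge> 0\<close>, the
  derivative of \<open>\<sigma>\<^sub>j\<close> is, in an eigenbasis, a nonnegative combination of the numbers
  \<open>\<sigma>\<^sub>j\<^sub>-\<^sub>1(\<lambda>|i)\<close>, where \<open>\<lambda>|i\<close> is \<open>\<lambda>\<close> without its \<open>i\<close>-th entry. These are nonnegative on the cone:
  by Gauss--Lucas, derivatives of \<open>\<Prod>\<^sub>l (z + \<lambda>\<^sub>l) + \<tau> \<Prod>\<^sub>l\<^sub>\<noteq>\<^sub>i (z + \<lambda>\<^sub>l)\<close> have no zeros in the upper
  half plane when \<open>Im \<tau> \<ge> 0\<close>.
\<close>

section \<open>Elementary symmetric functions with one variable deleted\<close>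

text \<open>The index set is a parameter so that deleting the \<open>i\<close>-th variable is
  passing to \<open>A - {i}\<close>; \<open>elem_sym\<close> always ranges over the full index
  type.\<close>

definition esym :: "'i set \<Rightarrow> nat \<Rightarrow> ('i \<Rightarrow> 'a::comm_semiring_1) \<Rightarrow> 'a" where
  "esym A j c = (\<Sum>S | S \<subseteq> A \<and> card S = j. \<Prod>i\<in>S. c i)"

text \<open>Vieta: in the expanded product, a set \<open>X\<close> contributing its constants leaves
  \<open>card A - card X\<close> factors of the variable.\<close>

lemma coeff_prod_linear:
  fixes c :: "'i \<Rightarrow> 'a::comm_ring_1"
  assumes "finite A" "j \<le> card A"
  shows "coeff (\<Prod>l\<in>A. [:c l, 1:]) (card A - j) = esym A j c"
proof -
  have "(\<Prod>l\<in>A. [:c l, 1:]) = (\<Prod>l\<in>A. [:c l:] + monom 1 1)"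
    by (simp add: monom_altdef)
  also have "\<dots> = (\<Sum>X\<in>Pow A. (\<Prod>l\<in>X. [:c l:]) * (\<Prod>l\<in>A-X. monom 1 1))"
    by (rule prod_add[OF assms(1)])
  also have "\<dots> = (\<Sum>X\<in>Pow A. monom (\<Prod>l\<in>X. c l) (card A - card X))"
  proof (rule sum.cong)
    fix X assume X: "X \<in> Pow A"
    then have fX: "finite X" using assms(1) finite_subset by auto
    have "(\<Prod>l\<in>X. [:c l:]) = [:\<Prod>l\<in>X. c l:]"
      using fX by (induction X) (auto simp: one_pCons)
    moreover have "(\<Prod>l\<in>A-X. monom 1 1 :: 'a poly) = monom 1 (card A - card X)"
      using X fX by (simp add: monom_power card_Diff_subset)
    ultimately show "(\<Prod>l\<in>X. [:c l:]) * (\<Prod>l\<in>A-X. monom 1 1) = monom (\<Prod>l\<in>X. c l) (card A - card X)"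
      by (simp add: smult_monom)
  qed simp
  finally have "coeff (\<Prod>l\<in>A. [:c l, 1:]) (card A - j)
      = (\<Sum>X\<in>Pow A. if card A - card X = card A - j then \<Prod>l\<in>X. c l else 0)"
    by (simp add: coeff_sum)
  \<comment> \<open>Subtraction is truncated, but neither \<open>card X\<close> nor \<open>j\<close>
    exceeds \<open>card A\<close>, so equal differences mean equal cardinalities.\<close>
  also have "\<dots> = (\<Sum>X\<in>Pow A. if card X = j then \<Prod>l\<in>X. c l else 0)"
  proof (rule sum.cong)
    fix X assume "X \<in> Pow A"
    then have "card X \<le> card A" using assms(1) by (simp add: card_mono)
    then show "(if card A - card X = card A - j then \<Prod>l\<in>X. c l else 0)
      = (if card X = j then \<Prod>l\<in>X. c l else 0)" using assms(2) by auto
  qed simp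
  also have "\<dots> = (\<Sum>X\<in>{X\<in>Pow A. card X = j}. \<Prod>l\<in>X. c l)"
    by (rule sum.inter_filter[symmetric]) (simp add: assms(1))
  finally show ?thesis unfolding esym_def by (simp add: Pow_def)
qed

lemma degree_prod_linear:
  fixes c :: "'i \<Rightarrow> 'a::idom"
  assumes "finite A"
  shows "degree (\<Prod>l\<in>A. [:c l, 1:]) = card A"
  by (subst degree_prod_sum_eq) auto

section \<open>Gauss-Lucas and polynomials without zeros in the upper half plane\<close>

text \<open>The factor \<open>s\<close> is the logarithmic derivative, the sum of
  \<open>1 / (z - a)\<close> over the roots; each summand has negative imaginary part because
  \<open>z - a\<close> lies in the upper half plane. The empty sum is kept apart since it is
  0.\<close>

lemma pderiv_prod_linear_logarithmic:
  fixes z :: complex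
  assumes "\<forall>a\<in>#R. Im a \<le> 0" and "Im z > 0"
  shows "poly (\<Prod>a\<in>#R. [:-a, 1:]) z \<noteq> 0 \<and>
    (\<exists>s. poly (pderiv (\<Prod>a\<in>#R. [:-a, 1:])) z = poly (\<Prod>a\<in>#R. [:-a, 1:]) z * s \<and>
      (if R = {#} then s = 0 else Im s < 0))"
  using assms(1)
proof (induction R)
  case empty
  then show ?case by (simp add: pderiv_1)
next
  case (add a R)
  let ?q = "\<Prod>a\<in>#R. [:-a, 1:]"
  obtain s where s: "poly (pderiv ?q) z = poly ?q z * s" "if R = {#} then s = 0 else Im s < 0"
    and nz: "poly ?q z \<noteq> 0"
    using add by auto
  have ia: "Im (z - a) > 0" using add.prems assms(2) by auto
  then have za: "z - a \<noteq> 0" by auto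
  have "Im (1 / (z - a)) < 0"
    using ia by (auto simp: Im_divide intro!: divide_neg_pos add_nonneg_pos)
  moreover have "poly (pderiv ([:-a, 1:] * ?q)) z = poly ([:-a, 1:] * ?q) z * (s + 1 / (z - a))"
    unfolding pderiv_mult poly_add poly_mult s using za by (simp add: pderiv_pCons field_simps)
  moreover have "poly ([:-a, 1:] * ?q) z \<noteq> 0"
    using za nz by simp
  ultimately show ?case using s(2)
    by (auto intro!: exI[of _ "s + 1 / (z - a)"] split: if_splits)
qed

text \<open>The roots lie in the closed lower half plane and there is at least one, so the
  logarithmic derivative at \<open>z\<close> has negative imaginary part and cannot vanish.\<close>

lemma Gauss_Lucas_upper_half_plane:
  fixes p :: "complex poly"
  assumes "degree p \<ge> 1" and nz: "\<And>z. Im z > 0 \<Longrightarrow> poly p z \<noteq> 0" and "Im z > 0"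
  shows "poly (pderiv p) z \<noteq> 0"
proof -
  have p0: "p \<noteq> 0" using assms by auto
  have R: "\<forall>a\<in>#proots p. Im a \<le> 0"
    using nz p0 by (force simp: not_less[symmetric])
  have ne: "proots p \<noteq> {#}"
    using assms(1) size_proots_complex[of p] by auto
  have dec: "p = smult (lead_coeff p) (\<Prod>x\<in>#proots p. [:-x, 1:])"
    by (rule complex_poly_decompose_multiset[symmetric])
  obtain s where "poly (pderiv (\<Prod>a\<in>#proots p. [:-a, 1:])) z = poly (\<Prod>a\<in>#proots p. [:-a, 1:]) z * s"
    "poly (\<Prod>a\<in>#proots p. [:-a, 1:]) z \<noteq> 0" "Im s < 0"
    using pderiv_prod_linear_logarithmic[OF R assms(3)] ne by auto
  moreover have "s \<noteq> 0" using \<open>Im s < 0\<close> by auto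
  ultimately show ?thesis
    using p0 by (subst dec) (simp add: pderiv_smult)
qed

lemma higher_pderiv_upper_half_plane:
  fixes p :: "complex poly"
  assumes "p \<noteq> 0" "m \<le> degree p" and "\<And>z. Im z > 0 \<Longrightarrow> poly p z \<noteq> 0" and "Im z > 0"
  shows "poly ((pderiv ^^ m) p) z \<noteq> 0"
  using assms(2,4)
proof (induction m arbitrary: z)
  case 0
  then show ?case using assms(3) by simp
next
  case (Suc m)
  have "poly (pderiv ((pderiv ^^ m) p)) z \<noteq> 0"
    by (rule Gauss_Lucas_upper_half_plane) (use Suc in \<open>auto simp: degree_higher_pderiv\<close>)
  then show ?case by simp
qed

text \<open>If \<open>q\<close> were negative at \<open>0\<close>, then \<open>h = q / p\<close> would have a positive derivative at some
  \<open>s > 0\<close>, so \<open>\<zeta> = h(s + i e)\<close> would lie in the upper half plane for small \<open>e > 0\<close> and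
  \<open>p + \<tau> q\<close> would vanish at \<open>s + i e\<close> for \<open>\<tau> = -1 / \<zeta>\<close>.\<close>

lemma nonneg_at_0_if_stable_pencil:
  fixes p q :: "real poly"
  assumes stable: "\<And>z \<tau>. Im z > 0 \<Longrightarrow> Im \<tau> \<ge> 0 \<Longrightarrow>
      poly (map_poly complex_of_real p) z + \<tau> * poly (map_poly complex_of_real q) z \<noteq> 0"
    and pos: "\<And>s. s \<ge> 0 \<Longrightarrow> poly p s > 0" and "lead_coeff q > 0"
  shows "poly q 0 \<ge> 0"
proof (rule ccontr)
  assume neg: "\<not> poly q 0 \<ge> 0"
  let ?P = "map_poly complex_of_real p" and ?Q = "map_poly complex_of_real q"
  define h where "h s = poly q s / poly p s" for s
  define h' where "h' s = (poly (pderiv q) s * poly p s - poly q s * poly (pderiv p) s) / (poly p s * poly p s)" for s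
  have pd: "map_poly complex_of_real (pderiv r) = pderiv (map_poly complex_of_real r)" for r
    by (intro poly_eqI) (simp add: coeff_map_poly coeff_pderiv)
  have pr: "poly (map_poly complex_of_real r) (complex_of_real s) = complex_of_real (poly r s)" for r s
    by (induction r) (simp_all add: map_poly_pCons)
  have dh: "(h has_real_derivative h' s) (at s)" if "s \<ge> 0" for s
    unfolding h_def h'_def using pos[OF that]
    by (auto intro!: derivative_eq_intros simp: divide_simps)
  \<comment> \<open>Here the sign of the leading coefficient enters: it makes \<open>h\<close>
    positive at some \<open>s1\<close>, while \<open>h 0 < 0\<close>, so the mean value theorem
    yields a point of positive slope.\<close>
  obtain n where n: "\<And>x. x \<ge> n \<Longrightarrow> poly q x \<ge> lead_coeff q"
    using poly_pinfty_gt_lc[OF assms(3)] by auto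
  define s1 where "s1 = max n 1"
  have s1: "s1 > 0" "poly q s1 > 0"
    using n[of s1] assms(3) by (auto simp: s1_def)
  have "\<exists>z>0. z < s1 \<and> h s1 - h 0 = (s1 - 0) * h' z"
    by (rule MVT2[OF s1(1)]) (use dh in auto)
  then obtain s0 where s0: "0 < s0" "s0 < s1" "h s1 - h 0 = s1 * h' s0" by auto
  have "h s1 > 0" "h 0 < 0"
    using s1 pos[of s1] pos[of 0] neg by (auto simp: h_def divide_neg_pos)
  then have "s1 * h' s0 > 0" using s0(3) by linarith
  then have h'pos: "h' s0 > 0" using s1(1) by (simp add: zero_less_mult_iff)
  define H where "H z = poly ?Q z / poly ?P z" for z
  have P0: "poly ?P (of_real s0) \<noteq> 0" using pr[of p s0] pos[of s0] s0 by simp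
  have H': "(H has_field_derivative of_real (h' s0)) (at (of_real s0))"
    unfolding H_def h'_def using P0
    by (auto intro!: derivative_eq_intros simp: divide_simps pr pd[symmetric])
  \<comment> \<open>Leaving the real axis vertically, \<open>H\<close> moves with velocity
    \<open>\<i> * h' s0\<close>, so its imaginary part, which is 0 on the axis, becomes
    positive.\<close>
  have "((\<lambda>e::real. H (of_real s0 + \<i> * of_real e)) has_vector_derivative (\<i> * of_real (h' s0))) (at 0)"
  proof -
    have "((\<lambda>e::real. of_real s0 + \<i> * of_real e) has_vector_derivative \<i>) (at 0)"
      by (auto intro!: derivative_eq_intros)
    from field_vector_diff_chain_at[OF this, of H "of_real (h' s0)"] H'
    show ?thesis by (simp add: o_def)
  qed
  then have "((\<lambda>e::real. Im (H (of_real s0 + \<i> * of_real e))) has_real_derivative h' s0) (at 0)"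
    using bounded_linear.has_vector_derivative[OF bounded_linear_Im]
    by (fastforce simp: has_real_derivative_iff_has_vector_derivative)
  from DERIV_pos_inc_right[OF this h'pos] obtain d where d: "d > 0"
    "\<And>e. 0 < e \<Longrightarrow> e < d \<Longrightarrow> Im (H (of_real s0)) < Im (H (of_real s0 + \<i> * of_real e))"
    by auto
  define z where "z = of_real s0 + \<i> * of_real (d/2)"
  define \<zeta> where "\<zeta> = H z"
  have "H (of_real s0) = of_real (h s0)" by (simp add: H_def h_def pr)
  then have im: "Im \<zeta> > 0" using d(2)[of "d/2"] d(1) by (simp add: z_def \<zeta>_def)
  have imz: "Im z > 0" using d(1) by (simp add: z_def)
  have Pz: "poly ?P z \<noteq> 0" using stable[OF imz, of 0] by simp
  have "\<zeta> \<noteq> 0" using im by auto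
  have "Im (- 1 / \<zeta>) \<ge> 0"
    using im by (auto simp: Im_divide intro!: divide_nonneg_nonneg)
  from stable[OF imz this] show False
    using \<open>\<zeta> \<noteq> 0\<close> Pz by (simp add: \<zeta>_def H_def field_simps)
qed

text \<open>Differentiating \<open>card A - k\<close> times removes exactly the coefficients
  \<open>esym A j c\<close> with \<open>j > k\<close>, whose signs are unknown, and makes
  \<open>esym (A - {i}) (k - 1) c\<close>, up to a positive factor, the value of \<open>q\<close> at
  0. Then \<open>nonneg_at_0_if_stable_pencil\<close> applies to \<open>p\<close> and
  \<open>q\<close>.\<close>

lemma esym_delete_nonneg:
  fixes c :: "'i \<Rightarrow> real"
  assumes "finite A" "i \<in> A" "1 \<le> k" "k \<le> card A"
    and pos: "\<And>j. 1 \<le> j \<Longrightarrow> j \<le> k \<Longrightarrow> esym A j c > 0"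
  shows "esym (A - {i}) (k - 1) c \<ge> 0"
proof -
  define m where "m = card A - k"
  define p where "p = (pderiv ^^ m) (\<Prod>l\<in>A. [:c l, 1:])"
  define q where "q = (pderiv ^^ m) (\<Prod>l\<in>A - {i}. [:c l, 1:])"
  have hp: "map_poly complex_of_real ((pderiv ^^ m) r) = (pderiv ^^ m) (map_poly complex_of_real r)" for r
    by (intro poly_eqI) (simp add: coeff_map_poly coeff_higher_pderiv pochhammer_of_real[symmetric])
  have mp: "map_poly complex_of_real (\<Prod>l\<in>B. [:c l, 1:]) = (\<Prod>l\<in>B. [:complex_of_real (c l), 1:])" if "finite B" for B
    using that
  proof (induction B)
    case (insert x B)
    have "map_poly complex_of_real (r * s) = map_poly complex_of_real r * map_poly complex_of_real s" for r s
      by (intro poly_eqI) (simp add: coeff_map_poly coeff_mult)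
    with insert show ?case by (simp add: map_poly_pCons del: mult_pCons_left)
  qed simp
  have cA: "card (A - {i}) = card A - 1" using assms by simp
  have stable: "poly (map_poly complex_of_real p) z + \<tau> * poly (map_poly complex_of_real q) z \<noteq> 0"
    if "Im z > 0" "Im \<tau> \<ge> 0" for z \<tau>
  proof -
    \<comment> \<open>Shifting the \<open>i\<close>-th constant by \<open>\<tau>\<close> realizes
      the pencil as one product of linear factors; since \<open>Im \<tau> \<ge> 0\<close>, no factor
      vanishes in the upper half plane.\<close>
    define d where "d l = (if l = i then of_real (c i) + \<tau> else complex_of_real (c l))" for l
    have "(\<Prod>l\<in>A. [:d l, 1:]) = [:of_real (c i) + \<tau>, 1:] * (\<Prod>l\<in>A-{i}. [:complex_of_real (c l), 1:])"
      by (subst prod.remove[OF assms(1,2)]) (auto simp: d_def intro!: arg_cong2[of _ _ _ _ "(*)"] prod.cong)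
    also have "\<dots> = (\<Prod>l\<in>A. [:complex_of_real (c l), 1:]) + smult \<tau> (\<Prod>l\<in>A-{i}. [:complex_of_real (c l), 1:])"
      by (subst prod.remove[OF assms(1,2), of "\<lambda>l. [:complex_of_real (c l), 1:]"]) (simp add: algebra_simps smult_add_left)
    finally have eq: "(pderiv ^^ m) (\<Prod>l\<in>A. [:d l, 1:]) = map_poly complex_of_real p + smult \<tau> (map_poly complex_of_real q)"
      using assms(1) by (simp add: p_def q_def hp mp higher_pderiv_add higher_pderiv_smult)
    have "poly ((pderiv ^^ m) (\<Prod>l\<in>A. [:d l, 1:])) z \<noteq> 0"
    proof (rule higher_pderiv_upper_half_plane)
      show "(\<Prod>l\<in>A. [:d l, 1:]) \<noteq> 0" using assms(1) by simp
      show "m \<le> degree (\<Prod>l\<in>A. [:d l, 1:])" using assms(1) by (simp add: degree_prod_linear m_def)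
      show "poly (\<Prod>l\<in>A. [:d l, 1:]) z \<noteq> 0" if "Im z > 0" for z
      proof -
        have "d l + z \<noteq> 0" for l
        proof -
          have "Im (d l + z) > 0" using that \<open>Im \<tau> \<ge> 0\<close> by (simp add: d_def)
          then show ?thesis by (metis less_irrefl zero_complex.sel(2))
        qed
        then show ?thesis using assms(1) by (simp add: poly_prod)
      qed
    qed fact
    then show ?thesis unfolding eq by simp
  qed
  have pochpos: "pochhammer (real (Suc j)) m > 0" for j by (intro pochhammer_pos) simp
  have pc: "coeff p j > 0" if "j \<le> k" for j
  proof -
    have "j + m = card A - (k - j)" using that assms by (simp add: m_def)
    then have "coeff p j = pochhammer (real (Suc j)) m * esym A (k - j) c"
      using coeff_prod_linear[OF assms(1), of "k - j" c] assms(4)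
      by (simp add: p_def coeff_higher_pderiv)
    moreover have "esym A (k - j) c > 0"
    proof (cases "j = k")
      case True
      have "{S. S \<subseteq> A \<and> card S = 0} = {{}}" using assms(1) finite_subset by fastforce
      then show ?thesis using True by (simp add: esym_def)
    qed (use pos that in auto)
    ultimately show ?thesis using pochpos by (metis mult_pos_pos)
  qed
  have dp: "degree p = k" using assms by (simp add: p_def degree_higher_pderiv degree_prod_linear m_def)
  have "poly p s > 0" if "s \<ge> 0" for s
  proof -
    have "poly p s = coeff p 0 + (\<Sum>j\<in>{1..k}. coeff p j * s ^ j)"
      by (simp add: poly_altdef dp sum.atLeast_Suc_atMost atMost_atLeast0)
    moreover have "(\<Sum>j\<in>{1..k}. coeff p j * s ^ j) \<ge> 0"
      by (intro sum_nonneg mult_nonneg_nonneg) (use pc that in \<open>auto intro: less_imp_le\<close>)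
    ultimately show ?thesis using pc[of 0] by linarith
  qed
  moreover have "lead_coeff q > 0"
  proof -
    have "degree q = k - 1" using assms by (simp add: q_def degree_higher_pderiv degree_prod_linear m_def cA)
    moreover have "k - 1 + m = card (A - {i}) - 0" using assms by (simp add: cA m_def)
    ultimately have "lead_coeff q = pochhammer (real (Suc (k - 1))) m * esym (A - {i}) 0 c"
      using coeff_prod_linear[of "A - {i}" 0 c] assms(1) by (simp add: q_def coeff_higher_pderiv)
    moreover have "{S. S \<subseteq> A - {i} \<and> card S = 0} = {{}}" using assms(1) finite_subset by fastforce
    ultimately show ?thesis using pochpos[of "k - 1"] by (simp add: esym_def)
  qed
  ultimately have "poly q 0 \<ge> 0"
    using nonneg_at_0_if_stable_pencil[OF stable] by blast
  moreover have "m = card (A - {i}) - (k - 1)" using assms by (simp add: cA m_def)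
  then have "poly q 0 = pochhammer (real (Suc 0)) m * esym (A - {i}) (k - 1) c"
    using coeff_prod_linear[of "A - {i}" "k - 1" c] assms(1,3,4)
    by (simp add: q_def coeff_higher_pderiv poly_0_coeff_0 cA)
  ultimately show ?thesis using pochpos[of 0] by (simp add: zero_le_mult_iff)
qed

section \<open>Diagonalization of symmetric matrices\<close>

definition diag :: "real^'n \<Rightarrow> real^'n^'n" where
  "diag d = (\<chi> i j. if i = j then d $ i else 0)"

lemma symmetric_inner: "transpose A = A \<Longrightarrow> (A *v x) \<bullet> y = x \<bullet> (A *v y)"
  for A :: "real^'n^'n::finite"
  by (metis dot_lmul_matrix inner_commute transpose_matrix_vector)

text \<open>A maximizer \<open>v\<close> of the quadratic form on the unit sphere of
  \<open>W\<close> is an eigenvector: \<open>T = \<mu> - A\<close> is positive semidefinite on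
  \<open>W\<close> with \<open>v \<bullet> T v = 0\<close>, and moving from \<open>v\<close> in the
  direction \<open>T v\<close> shows \<open>T v = 0\<close>.\<close>

lemma symmetric_has_eigenvector:
  fixes A :: "real^'n^'n::finite"
  assumes sym: "transpose A = A" and W: "subspace W" "W \<noteq> {0}" and inv: "\<And>x. x \<in> W \<Longrightarrow> A *v x \<in> W"
  obtains v \<mu> where "v \<in> W" "norm v = 1" "A *v v = \<mu> *\<^sub>R v"
proof -
  let ?S = "W \<inter> sphere 0 1"
  have "compact ?S" using W(1) by (simp add: closed_Int_compact closed_subspace)
  moreover obtain x where "x \<in> W" "x \<noteq> 0" using W subspace_0 by blast
  then have "x /\<^sub>R norm x \<in> ?S" using W(1) by (simp add: subspace_scale)
  then have "?S \<noteq> {}" by blast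
  moreover have "continuous_on ?S (\<lambda>x. x \<bullet> (A *v x))"
    by (intro continuous_intros linear_continuous_on) (simp add: linear_linear)
  ultimately obtain v where v: "v \<in> ?S" "\<And>y. y \<in> ?S \<Longrightarrow> y \<bullet> (A *v y) \<le> v \<bullet> (A *v v)"
    using continuous_attains_sup by (metis (no_types, lifting))
  define \<mu> where "\<mu> = v \<bullet> (A *v v)"
  define T where "T x = \<mu> *\<^sub>R x - A *v x" for x
  have vv: "v \<bullet> v = 1" using v(1) by (simp add: norm_eq_1)
  have Tsym: "T x \<bullet> y = x \<bullet> T y" for x y
    using symmetric_inner[OF sym, of x y] by (simp add: T_def inner_diff_left inner_diff_right)
  have Tadd: "T (x + s *\<^sub>R y) = T x + s *\<^sub>R T y" for x y s
    by (simp add: T_def matrix_vector_right_distrib matrix_vector_mult_scaleR algebra_simps)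
  have psd: "0 \<le> x \<bullet> T x" if "x \<in> W" for x
  proof (cases "x = 0")
    case False
    have "(x /\<^sub>R norm x) \<bullet> (A *v (x /\<^sub>R norm x)) \<le> \<mu>"
      unfolding \<mu>_def using that False W(1) by (intro v(2)) (simp add: subspace_scale)
    then have "(x \<bullet> (A *v x)) / (norm x)\<^sup>2 \<le> \<mu>"
      by (simp add: matrix_vector_mult_scaleR power2_eq_square divide_inverse mult_ac)
    then have "x \<bullet> (A *v x) \<le> \<mu> * (x \<bullet> x)"
      using False by (simp add: divide_le_eq power2_norm_eq_inner)
    then show ?thesis by (simp add: T_def inner_diff_right)
  qed (simp add: T_def)
  have vT: "v \<bullet> T v = 0" by (simp add: T_def inner_diff_right vv \<mu>_def)
  have TvW: "T v \<in> W" using v(1) W(1) inv by (simp add: T_def subspace_diff subspace_scale)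
  define a where "a = T v \<bullet> T v"
  define b where "b = T v \<bullet> T (T v)"
  have q: "0 \<le> 2 * s * a + s\<^sup>2 * b" for s
  proof -
    have "v + s *\<^sub>R T v \<in> W" using v(1) W(1) TvW by (simp add: subspace_add subspace_scale)
    from psd[OF this] show ?thesis
      using Tsym[of v "T v"]
      by (simp add: Tadd inner_add_left inner_add_right vT a_def b_def power2_eq_square algebra_simps)
  qed
  have "b \<ge> 0" unfolding b_def by (rule psd[OF TvW])
  have "a = 0"
  proof (rule ccontr)
    assume "a \<noteq> 0"
    then have "a > 0" by (simp add: a_def)
    \<comment> \<open>The minimizer of the quadratic in \<open>q\<close> is \<open>- a / b\<close>;
      the added 1 permits \<open>b = 0\<close> and still leaves a negative value.\<close>
    define s where "s = - a / (b + 1)"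
    have "b * a / (b + 1) < 2 * a" using mult_nonneg_nonneg[OF \<open>b \<ge> 0\<close> less_imp_le[OF \<open>a > 0\<close>]] \<open>b \<ge> 0\<close> \<open>a > 0\<close>
      by (simp add: divide_less_eq algebra_simps add_nonneg_pos)
    moreover have "2 * s * a + s\<^sup>2 * b = (a / (b + 1)) * (b * a / (b + 1) - 2 * a)"
      by (simp add: s_def power2_eq_square algebra_simps)
    moreover have "a / (b + 1) > 0" using \<open>b \<ge> 0\<close> \<open>a > 0\<close> by simp
    ultimately have "2 * s * a + s\<^sup>2 * b < 0" by (metis diff_less_0_iff_less mult_pos_neg)
    then show False using q[of s] by simp
  qed
  then have "A *v v = \<mu> *\<^sub>R v" by (simp add: a_def T_def)
  then show ?thesis using that v(1) by auto
qed

text \<open>An orthonormal set of eigenvectors of maximal size is a basis: otherwise its orthogonal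
  complement is a nonzero invariant subspace and supplies one more.\<close>

theorem symmetric_diagonalizable:
  fixes A :: "real^'n^'n::finite"
  assumes sym: "transpose A = A"
  obtains Q d where "orthogonal_matrix Q" "A = Q ** diag d ** transpose Q"
proof -
  define good where "good B \<longleftrightarrow> finite B \<and> pairwise orthogonal B \<and> (\<forall>b\<in>B. norm b = 1 \<and> (\<exists>\<mu>. A *v b = \<mu> *\<^sub>R b))"
    for B :: "(real^'n) set"
  have indep: "independent B" if "good B" for B
    using that unfolding good_def by (intro pairwise_orthogonal_independent) auto
  have le: "card B \<le> CARD('n)" if "good B" for B
    using independent_bound[OF indep[OF that]] by simp
  have "good {}" by (simp add: good_def)
  then have "\<exists>B. good B \<and> (\<forall>C. good C \<longrightarrow> card C \<le> card B)"
    by (rule ex_has_greatest_nat[where b = "Suc CARD('n)"]) (simp add: le less_Suc_eq_le)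
  then obtain B where B: "good B" and max: "\<And>C. good C \<Longrightarrow> card C \<le> card B"
    by blast
  have cB: "card B = CARD('n)"
  proof (rule ccontr)
    assume "card B \<noteq> CARD('n)"
    then have "dim B < DIM(real^'n)" using le[OF B] dim_eq_card_independent[OF indep[OF B]] by simp
    then obtain x where x: "x \<noteq> 0" "\<And>y. y \<in> span B \<Longrightarrow> orthogonal x y"
      using orthogonal_to_subspace_exists by blast
    define W where "W = {x. \<forall>b\<in>B. b \<bullet> x = 0}"
    have "subspace W" by (auto simp: subspace_def W_def inner_add_right)
    moreover have "x \<in> W" using x span_base by (auto simp: W_def orthogonal_def inner_commute)
    then have "W \<noteq> {0}" using x by auto
    moreover have "A *v y \<in> W" if "y \<in> W" for y
    proof -
      have "b \<bullet> (A *v y) = 0" if "b \<in> B" for b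
      proof -
        have "\<exists>\<mu>. A *v b = \<mu> *\<^sub>R b" using B that by (simp add: good_def)
        then obtain \<mu> where "A *v b = \<mu> *\<^sub>R b" ..
        then show ?thesis using symmetric_inner[OF sym, of b y] \<open>y \<in> W\<close> that by (simp add: W_def)
      qed
      then show ?thesis by (simp add: W_def)
    qed
    ultimately obtain v \<mu> where v: "v \<in> W" "norm v = 1" "A *v v = \<mu> *\<^sub>R v"
      using symmetric_has_eigenvector[OF sym] by metis
    have "v \<notin> B" using v by (auto simp: W_def)
    moreover have "good (insert v B)"
      using B v by (auto simp: good_def pairwise_insert W_def orthogonal_def inner_commute)
    ultimately show False using max[of "insert v B"] B by (simp add: good_def)
  qed
  have "finite B" using B by (simp add: good_def)
  then obtain q where q: "bij_betw q (UNIV :: 'n set) B"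
    using cB by (metis finite_same_card_bij finite_UNIV finite)
  then have qB: "q i \<in> B" for i using bij_betwE by blast
  have qq: "q i \<bullet> q j = (if i = j then 1 else 0)" for i j
  proof (cases "i = j")
    case True
    then show ?thesis using B qB[of j] by (simp add: good_def norm_eq_1)
  next
    case False
    then have "q i \<noteq> q j" using q by (metis bij_betw_inv_into_left UNIV_I)
    then show ?thesis using B qB[of i] qB[of j] False by (auto simp: good_def pairwise_def orthogonal_def)
  qed
  define d where "d = (\<chi> i. SOME \<mu>. A *v q i = \<mu> *\<^sub>R q i)"
  have Aq: "A *v q i = d $ i *\<^sub>R q i" for i
    unfolding d_def using B qB[of i] by (simp add: good_def) (metis (mono_tags, lifting) someI_ex)
  define Q where "Q = (\<chi> i j. q j $ i)"
  have oQ: "orthogonal_matrix Q"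
    unfolding orthogonal_matrix
    using qq by (simp add: Q_def vec_eq_iff matrix_matrix_mult_def transpose_def mat_def inner_vec_def)
  have "A ** Q = Q ** diag d"
  proof -
    have "(A ** Q) $ i $ j = (A *v q j) $ i" for i j
      by (simp add: matrix_matrix_mult_def matrix_vector_mult_def Q_def)
    moreover have "(Q ** diag d) $ i $ j = d $ j * q j $ i" for i j
      by (simp add: matrix_matrix_mult_def Q_def diag_def if_distrib cong: if_cong)
    ultimately show ?thesis by (simp add: vec_eq_iff Aq)
  qed
  then have "Q ** diag d ** transpose Q = A ** (Q ** transpose Q)"
    by (simp add: matrix_mul_assoc)
  also have "\<dots> = A" using oQ by (simp add: orthogonal_matrix_def)
  finally show ?thesis using that oQ by metis
qed

section \<open>Elementary symmetric functions of the eigenvalues as polynomials in the entries\<close>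

text \<open>The principal minor with rows and columns in \<open>S\<close>, by the Leibniz formula,
  so that no matrix indexed by \<open>S\<close> has to be formed.\<close>

definition pminor :: "'n set \<Rightarrow> real^'n^'n::finite \<Rightarrow> real" where
  "pminor S A = (\<Sum>p | p permutes S. of_int (sign p) * (\<Prod>i\<in>S. A $ i $ p i))"

text \<open>Up to sign a coefficient of the characteristic polynomial, so for symmetric matrices it
  is \<open>sigma\<close>, but polynomial in the entries and free of any choice of
  eigenvalues.\<close>

definition msym :: "nat \<Rightarrow> real^'n^'n::finite \<Rightarrow> real" where
  "msym j A = (\<Sum>S | card S = j. pminor S A)"

text \<open>In the Leibniz formula a factor \<open>x\<close> can be taken only at a fixed point of
  \<open>p\<close>, so the set \<open>S\<close> of the remaining indices is permuted by
  \<open>p\<close>.\<close>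

lemma det_shift_expansion:
  fixes A :: "real^'n^'n::finite"
  shows "det (mat x + A) = (\<Sum>j\<le>CARD('n). x ^ (CARD('n) - j) * msym j A)"
proof -
  let ?U = "UNIV :: 'n set"
  have fp: "finite {p. p permutes ?U}" by (simp add: finite_permutations)
  have prodp: "(\<Prod>i\<in>?U. (mat x + A) $ i $ p i)
     = (\<Sum>S\<in>UNIV. if p permutes S then x ^ (CARD('n) - card S) * (\<Prod>i\<in>S. A $ i $ p i) else 0)"
    if p: "p permutes ?U" for p
  proof -
    have "(\<Prod>i\<in>?U. (mat x + A) $ i $ p i) = (\<Prod>i\<in>?U. A $ i $ p i + (if i = p i then x else 0))"
      by (intro prod.cong) (auto simp: mat_def)
    also have "\<dots> = (\<Sum>S\<in>UNIV. (\<Prod>i\<in>S. A $ i $ p i) * (\<Prod>i\<in>UNIV-S. if i = p i then x else 0))"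
      by (subst prod_add) auto
    also have "\<dots> = (\<Sum>S\<in>UNIV. if p permutes S then x ^ (CARD('n) - card S) * (\<Prod>i\<in>S. A $ i $ p i) else 0)"
    proof (rule sum.cong)
      fix S :: "'n set"
      show "(\<Prod>i\<in>S. A $ i $ p i) * (\<Prod>i\<in>UNIV-S. if i = p i then x else 0) =
        (if p permutes S then x ^ (CARD('n) - card S) * (\<Prod>i\<in>S. A $ i $ p i) else 0)"
      proof (cases "p permutes S")
        case True
        then have "(\<Prod>i\<in>UNIV-S. if i = p i then x else 0) = (\<Prod>i\<in>UNIV-S. x)"
          by (intro prod.cong) (auto simp: permutes_def)
        also have "\<dots> = x ^ (CARD('n) - card S)" by (simp add: card_Diff_subset)
        finally show ?thesis using True by simp
      next
        case False
        then obtain i where "i \<notin> S" "p i \<noteq> i" using p by (auto simp: permutes_def)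
        then have "(\<Prod>i\<in>UNIV-S. if i = p i then x else 0) = 0"
          by (intro prod_zero) (auto intro!: bexI[of _ i])
        then show ?thesis using False by simp
      qed
    qed simp
    finally show ?thesis .
  qed
  have sub: "{p \<in> {p. p permutes ?U}. p permutes S} = {p. p permutes S}" for S
    by (auto intro: permutes_subset)
  have "det (mat x + A) = (\<Sum>p | p permutes ?U. \<Sum>S\<in>UNIV.
     if p permutes S then x ^ (CARD('n) - card S) * (of_int (sign p) * (\<Prod>i\<in>S. A $ i $ p i)) else 0)"
    unfolding det_def
  proof (rule sum.cong)
    fix p assume "p \<in> {p. p permutes ?U}"
    then have "p permutes ?U" by simp
    show "of_int (sign p) * (\<Prod>i\<in>?U. (mat x + A) $ i $ p i) = (\<Sum>S\<in>UNIV.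
     if p permutes S then x ^ (CARD('n) - card S) * (of_int (sign p) * (\<Prod>i\<in>S. A $ i $ p i)) else 0)"
      unfolding prodp[OF \<open>p permutes ?U\<close>] sum_distrib_left by (intro sum.cong) auto
  qed simp
  also have "\<dots> = (\<Sum>S\<in>UNIV. \<Sum>p | p permutes ?U.
     if p permutes S then x ^ (CARD('n) - card S) * (of_int (sign p) * (\<Prod>i\<in>S. A $ i $ p i)) else 0)"
    by (rule sum.swap)
  also have "\<dots> = (\<Sum>S\<in>UNIV. x ^ (CARD('n) - card S) * pminor S A)"
  proof (rule sum.cong)
    fix S :: "'n set"
    show "(\<Sum>p | p permutes ?U. if p permutes S then x ^ (CARD('n) - card S) * (of_int (sign p) * (\<Prod>i\<in>S. A $ i $ p i)) else 0)
      = x ^ (CARD('n) - card S) * pminor S A"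
      by (simp only: sum.inter_filter[OF fp, symmetric] sub) (simp add: pminor_def sum_distrib_left)
  qed simp
  also have "\<dots> = (\<Sum>j\<le>CARD('n). \<Sum>S | S \<in> UNIV \<and> card S = j. x ^ (CARD('n) - card S) * pminor S A)"
    by (rule sum.group[symmetric]) (auto intro: card_mono)
  also have "\<dots> = (\<Sum>j\<le>CARD('n). x ^ (CARD('n) - j) * msym j A)"
    by (intro sum.cong) (auto simp: msym_def sum_distrib_left)
  finally show ?thesis .
qed

text \<open>The numbers \<open>msym j\<close> with \<open>j \<le> CARD('n)\<close> are the
  coefficients of the polynomial \<open>det (mat x + A)\<close>; for larger \<open>j\<close> there
  are no sets \<open>S\<close>.\<close>

lemma msym_cong_det:
  fixes A B :: "real^'n^'n::finite"
  assumes "\<And>x. det (mat x + A) = det (mat x + B)"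
  shows "msym j A = msym j B"
proof (cases "j \<le> CARD('n)")
  case True
  define P where "P C = (\<Sum>j\<le>CARD('n). monom (msym j C) (CARD('n) - j))" for C :: "real^'n^'n"
  have "poly (P C) x = det (mat x + C)" for C x
    by (simp add: P_def det_shift_expansion poly_sum poly_monom mult.commute)
  then have "P A = P B" using assms by (simp add: poly_eq_poly_eq_iff[symmetric] fun_eq_iff)
  moreover have "coeff (P C) (CARD('n) - j) = msym j C" for C
  proof -
    have "coeff (P C) (CARD('n) - j) = (\<Sum>i\<le>CARD('n). if CARD('n) - i = CARD('n) - j then msym i C else 0)"
      by (simp add: P_def coeff_sum)
    also have "\<dots> = (\<Sum>i\<le>CARD('n). if i = j then msym i C else 0)"
      by (intro sum.cong) (use True in auto)
    also have "\<dots> = msym j C" using True by simp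
    finally show ?thesis .
  qed
  ultimately show ?thesis by metis
next
  case False
  then have "{S :: 'n set. card S = j} = {}" using card_mono[OF finite, of _ "UNIV :: 'n set"] by auto
  then show ?thesis by (simp only: msym_def) simp
qed

lemma mat_matrix_mult: "mat x ** A = x *\<^sub>R A" and matrix_mult_mat: "A ** mat x = x *\<^sub>R A"
  for A :: "real^'n^'n::finite"
  by (simp_all add: vec_eq_iff matrix_matrix_mult_def mat_def if_distrib[where f="\<lambda>y. y * _"]
      if_distrib[where f="\<lambda>y. _ * y"] cong: if_cong)

lemma matrix_add_mult_distrib: "(A + B) ** C = A ** C + B ** C"
  for A B :: "real^'n^'m"
  by (simp add: vec_eq_iff matrix_matrix_mult_def sum.distrib distrib_right)

lemma det_shift_similar:
  fixes B Q :: "real^'n^'n::finite"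
  assumes Q: "orthogonal_matrix Q"
  shows "det (mat x + Q ** B ** transpose Q) = det (mat x + B)"
proof -
  have QQ: "Q ** transpose Q = mat 1" using Q by (simp add: orthogonal_matrix_def)
  then have "Q ** mat x ** transpose Q = mat x"
    by (simp add: matrix_mult_mat flip: scalar_matrix_assoc) (simp add: vec_eq_iff mat_def)
  then have "mat x + Q ** B ** transpose Q = Q ** (mat x + B) ** transpose Q"
    by (simp add: matrix_add_ldistrib matrix_add_mult_distrib)
  then have "det (mat x + Q ** B ** transpose Q) = det (Q ** transpose Q) * det (mat x + B)"
    by (simp add: det_mul)
  then show ?thesis by (simp add: QQ)
qed

lemma msym_similar:
  "orthogonal_matrix Q \<Longrightarrow> msym j (Q ** B ** transpose Q) = msym j B"
  by (intro msym_cong_det det_shift_similar)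

lemma pminor_diag: "pminor S (diag d) = (\<Prod>i\<in>S. d $ i)"
proof -
  have "(\<Sum>p | p permutes S. of_int (sign p) * (\<Prod>i\<in>S. diag d $ i $ p i))
     = (\<Sum>p | p permutes S. if p = id then (\<Prod>i\<in>S. d $ i) else 0)"
  proof (rule sum.cong)
    fix p assume "p \<in> {p. p permutes S}"
    then have p: "p permutes S" by simp
    show "of_int (sign p) * (\<Prod>i\<in>S. diag d $ i $ p i) = (if p = id then (\<Prod>i\<in>S. d $ i) else 0)"
    proof (cases "p = id")
      case False
      then obtain i where i: "p i \<noteq> i" by (auto simp: fun_eq_iff)
      then have "i \<in> S" using p by (auto simp: permutes_def)
      then have "(\<Prod>i\<in>S. diag d $ i $ p i) = 0" using i
        by (intro prod_zero) (auto intro!: bexI[of _ i] simp: diag_def)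
      then show ?thesis using False by simp
    qed (simp add: diag_def sign_id)
  qed simp
  also have "\<dots> = (\<Prod>i\<in>S. d $ i)" using permutes_id[of S] by (simp add: finite_permutations)
  finally show ?thesis by (simp add: pminor_def)
qed

lemma msym_diag: "msym j (diag d) = elem_sym j d"
  by (simp add: msym_def elem_sym_def pminor_diag)

lemma elem_sym_eq_esym: "elem_sym j d = esym UNIV j (($) d)"
  by (simp add: elem_sym_def esym_def)

lemma det_mat_plus_diag: "det (mat x + diag d) = (\<Prod>i\<in>UNIV. x + d $ i)"
  by (subst det_diagonal) (auto simp: mat_def diag_def)

text \<open>Removes the choice operator: diagonalization provides a vector of roots, so the chosen
  one satisfies the same identity, and that identity determines every \<open>msym\<close>.\<close>

lemma elem_sym_eigenvalues_eq_msym: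
  fixes M :: "real^'n^'n::finite"
  assumes sym: "transpose M = M"
  shows "elem_sym j (eigenvalues M) = msym j M"
proof -
  obtain Q d where Q: "orthogonal_matrix Q" and M: "M = Q ** diag d ** transpose Q"
    using symmetric_diagonalizable[OF sym] by blast
  have "det (mat x - M) = (\<Prod>i\<in>UNIV. x - d $ i)" for x
  proof -
    have "- M = Q ** diag (- d) ** transpose Q"
    proof -
      have "diag (- d) = (-1) *\<^sub>R diag d" by (simp add: vec_eq_iff diag_def)
      moreover have "Q ** ((-1) *\<^sub>R diag d) ** transpose Q = (-1) *\<^sub>R M"
        by (simp only: M matrix_scalar_ac scalar_matrix_assoc)
      ultimately show ?thesis by simp
    qed
    then have "mat x - M = mat x + Q ** diag (- d) ** transpose Q"
      by (metis add_uminus_conv_diff)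
    then have "det (mat x - M) = (\<Prod>i\<in>UNIV. x + (- d) $ i)"
      by (simp only: det_shift_similar[OF Q] det_mat_plus_diag)
    then show ?thesis by simp
  qed
  then have ex: "\<exists>l :: real^'n. \<forall>x. det (mat x - M) = (\<Prod>i\<in>UNIV. x - l $ i)"
    by (intro exI[of _ d] allI)
  define l where "l = eigenvalues M"
  have l: "det (mat x - M) = (\<Prod>i\<in>UNIV. x - l $ i)" for x
    using someI_ex[OF ex] unfolding l_def eigenvalues_def by (rule allE)
  \<comment> \<open>\<open>eigenvalues\<close> refers to \<open>det (mat x - M)\<close> and
    \<open>msym\<close> to \<open>det (mat x + M)\<close>; the passage replaces \<open>x\<close> by
    \<open>- x\<close> at the cost of this sign.\<close>
  have neg: "det (- A) = (-1) ^ CARD('n) * det A" for A :: "real^'n^'n"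
  proof -
    have "- A = mat (-1) ** A" by (simp add: mat_matrix_mult)
    moreover have "det (mat (-1) :: real^'n^'n) = (-1) ^ CARD('n)"
      by (subst det_diagonal) (auto simp: mat_def)
    ultimately show ?thesis by (simp only: det_mul)
  qed
  have "msym j M = msym j (diag l)"
  proof (rule msym_cong_det)
    fix x
    have "mat x + M = - (mat (- x) - M)" by (simp add: vec_eq_iff mat_def)
    then have "det (mat x + M) = (-1) ^ CARD('n) * det (mat (- x) - M)"
      using neg by metis
    also have "\<dots> = (\<Prod>i\<in>(UNIV::'n set). -1) * (\<Prod>i\<in>UNIV. - x - l $ i)"
      unfolding l by simp
    also have "\<dots> = (\<Prod>i\<in>UNIV. -1 * (- x - l $ i))"
      by (rule prod.distrib[symmetric])
    also have "\<dots> = (\<Prod>i\<in>UNIV. x + l $ i)"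
      by (intro prod.cong) auto
    also have "\<dots> = det (mat x + diag l)"
      by (rule det_mat_plus_diag[symmetric])
    finally show "det (mat x + M) = det (mat x + diag l)" .
  qed
  then show ?thesis unfolding msym_diag l_def by (rule HOL.sym)
qed

section \<open>First-order expansion and monotonicity\<close>

text \<open>Induction with all three bounds at once: the new remainder is \<open>\<epsilon>\<^sup>2
  * (b x * L) + (a x + \<epsilon> * b x) * R\<close>, so it needs the bound on the linear term,
  which in turn needs that on the product. The factor \<open>3 * K\<close> is \<open>K\<close> plus
  \<open>2 * K\<close> from these two summands.\<close>

lemma prod_perturbation:
  fixes a b :: "'i \<Rightarrow> real"
  assumes "finite A" and K: "K \<ge> 0" and e: "\<bar>\<epsilon>\<bar> \<le> 1"
    and "\<forall>i\<in>A. \<bar>a i\<bar> \<le> K \<and> \<bar>b i\<bar> \<le> K"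
  shows "\<bar>\<Prod>i\<in>A. a i\<bar> \<le> (3 * K) ^ card A \<and>
    \<bar>\<Sum>i\<in>A. b i * (\<Prod>l\<in>A-{i}. a l)\<bar> \<le> (3 * K) ^ card A \<and>
    \<bar>(\<Prod>i\<in>A. a i + \<epsilon> * b i) - (\<Prod>i\<in>A. a i) - \<epsilon> * (\<Sum>i\<in>A. b i * (\<Prod>l\<in>A-{i}. a l))\<bar>
      \<le> (3 * K) ^ card A * \<epsilon>\<^sup>2"
  using assms(1,4)
proof (induction A)
  case (insert x A)
  define P where "P = (\<Prod>i\<in>A. a i)"
  define L where "L = (\<Sum>i\<in>A. b i * (\<Prod>l\<in>A-{i}. a l))"
  define R where "R = (\<Prod>i\<in>A. a i + \<epsilon> * b i) - P - \<epsilon> * L"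
  define C where "C = (3 * K) ^ card A"
  have C: "C \<ge> 0" using K by (simp add: C_def)
  have IH: "\<bar>P\<bar> \<le> C" "\<bar>L\<bar> \<le> C" "\<bar>R\<bar> \<le> C * \<epsilon>\<^sup>2"
    using insert by (auto simp: P_def L_def R_def C_def)
  have ab: "\<bar>a x\<bar> \<le> K" "\<bar>b x\<bar> \<le> K" using insert.prems by auto
  have C': "(3 * K) ^ card (insert x A) = 3 * K * C" using insert by (simp add: C_def)
  have KC: "K * C \<ge> 0" using K C by simp
  have L': "(\<Sum>i\<in>insert x A. b i * (\<Prod>l\<in>insert x A-{i}. a l)) = b x * P + a x * L"
  proof -
    have "(\<Prod>l\<in>insert x A-{i}. a l) = a x * (\<Prod>l\<in>A-{i}. a l)" if "i \<in> A" for i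
    proof -
      have "insert x A - {i} = insert x (A - {i})" using that insert.hyps by auto
      then show ?thesis using insert.hyps by simp
    qed
    then have "(\<Sum>i\<in>A. b i * (\<Prod>l\<in>insert x A-{i}. a l)) = a x * L"
      by (simp add: L_def sum_distrib_left mult_ac cong: sum.cong)
    then show ?thesis using insert.hyps by (simp add: P_def)
  qed
  have m: "\<bar>u * v\<bar> \<le> s * t" if "\<bar>u\<bar> \<le> s" "\<bar>v\<bar> \<le> t" for u v s t :: real
    using that by (simp add: abs_mult mult_mono')
  have 1: "\<bar>a x * P\<bar> \<le> K * C" by (rule m[OF ab(1) IH(1)])
  have 2: "\<bar>b x * P\<bar> \<le> K * C" by (rule m[OF ab(2) IH(1)])
  have 3: "\<bar>a x * L\<bar> \<le> K * C" by (rule m[OF ab(1) IH(2)])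
  have 4: "\<bar>b x * L\<bar> \<le> K * C" by (rule m[OF ab(2) IH(2)])
  have 5: "\<bar>(a x + \<epsilon> * b x) * R\<bar> \<le> (2 * K) * (C * \<epsilon>\<^sup>2)"
  proof (rule m[OF _ IH(3)])
    have "\<bar>\<epsilon> * b x\<bar> \<le> 1 * K" by (rule m[OF e ab(2)])
    then show "\<bar>a x + \<epsilon> * b x\<bar> \<le> 2 * K" using ab by linarith
  qed
  have "(\<Prod>i\<in>insert x A. a i + \<epsilon> * b i) - (\<Prod>i\<in>insert x A. a i) - \<epsilon> * (b x * P + a x * L)
     = \<epsilon>\<^sup>2 * (b x * L) + (a x + \<epsilon> * b x) * R"
    using insert.hyps by (simp add: R_def P_def algebra_simps power2_eq_square)
  moreover have "\<bar>\<epsilon>\<^sup>2 * (b x * L)\<bar> \<le> \<epsilon>\<^sup>2 * (K * C)" by (rule m[OF _ 4]) simp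
  ultimately have "\<bar>(\<Prod>i\<in>insert x A. a i + \<epsilon> * b i) - (\<Prod>i\<in>insert x A. a i) - \<epsilon> * (b x * P + a x * L)\<bar>
      \<le> 3 * K * C * \<epsilon>\<^sup>2"
    using 5 by (simp add: algebra_simps)
  then show ?case
    unfolding L' C' using 1 2 3 KC insert.hyps by (simp add: P_def)
qed simp

text \<open>Only the identity contributes to orders 0 and 1. Any other permutation moves at least
  two indices, where the diagonal matrix has zeros, and one of these survives the removal of a
  single factor.\<close>

lemma pminor_perturbation:
  fixes d :: "real^'n::finite" and M :: "real^'n^'n"
  assumes K: "K \<ge> 0" and e: "\<bar>\<epsilon>\<bar> \<le> 1" and d: "\<And>i. \<bar>d $ i\<bar> \<le> K" and M: "\<And>i j. \<bar>M $ i $ j\<bar> \<le> K"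
  shows "\<bar>pminor S (diag d + \<epsilon> *\<^sub>R M) - (\<Prod>i\<in>S. d $ i) - \<epsilon> * (\<Sum>i\<in>S. M $ i $ i * (\<Prod>l\<in>S-{i}. d $ l))\<bar>
     \<le> real (card {p. p permutes S}) * (3 * K) ^ card S * \<epsilon>\<^sup>2"
proof -
  define a where "a p i = diag d $ i $ p i" for p :: "'n \<Rightarrow> 'n" and i
  define b where "b p i = M $ i $ p i" for p :: "'n \<Rightarrow> 'n" and i
  define P where "P p = (\<Prod>i\<in>S. a p i)" for p
  define L where "L p = (\<Sum>i\<in>S. b p i * (\<Prod>l\<in>S-{i}. a p l))" for p
  define G where "G p = (\<Prod>i\<in>S. a p i + \<epsilon> * b p i)" for p
  have fp: "finite {p. p permutes S}" by (simp add: finite_permutations)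
  have zero: "P p = 0 \<and> L p = 0" if p: "p permutes S" "p \<noteq> id" for p
  proof -
    obtain i where i: "p i \<noteq> i" using p(2) by (auto simp: fun_eq_iff)
    define j where "j = p i"
    have "p j \<noteq> j" using i p(1) by (metis j_def permutes_inverses(2))
    moreover have "i \<in> S" using p(1) i by (auto simp: permutes_def)
    moreover have "j \<in> S" using p(1) \<open>i \<in> S\<close> by (simp add: j_def permutes_in_image)
    moreover have "i \<noteq> j" using i by (simp add: j_def)
    moreover have z: "a p i = 0" if "p i \<noteq> i" for i using that by (simp add: a_def diag_def)
    ultimately have "(\<Prod>l\<in>S-{k}. a p l) = 0" for k
      using i by (intro prod_zero) (simp, metis DiffI singletonD)
    moreover have "P p = 0" unfolding P_def
      using z[OF i] \<open>i \<in> S\<close> by (intro prod_zero) auto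
    ultimately show ?thesis by (simp add: L_def del: prod_zero_iff)
  qed
  have sumid: "(\<Sum>p | p permutes S. of_int (sign p) * X p) = X id" if "\<And>p. p permutes S \<Longrightarrow> p \<noteq> id \<Longrightarrow> X p = 0" for X :: "_ \<Rightarrow> real"
  proof -
    have "(\<Sum>p | p permutes S. of_int (sign p) * X p) = (\<Sum>p | p permutes S. if p = id then X id else 0)"
      by (intro sum.cong) (use that in \<open>auto simp: sign_id\<close>)
    then show ?thesis using permutes_id[of S] fp by simp
  qed
  have "P id = (\<Prod>i\<in>S. d $ i)" "L id = (\<Sum>i\<in>S. M $ i $ i * (\<Prod>l\<in>S-{i}. d $ l))"
    by (simp_all add: P_def L_def a_def b_def diag_def)
  then have "pminor S (diag d + \<epsilon> *\<^sub>R M) - (\<Prod>i\<in>S. d $ i) - \<epsilon> * (\<Sum>i\<in>S. M $ i $ i * (\<Prod>l\<in>S-{i}. d $ l))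
    = (\<Sum>p | p permutes S. of_int (sign p) * G p) - (\<Sum>p | p permutes S. of_int (sign p) * P p)
       - \<epsilon> * (\<Sum>p | p permutes S. of_int (sign p) * L p)"
    using zero by (subst (1 2) sumid) (auto simp: pminor_def G_def a_def b_def)
  also have "\<dots> = (\<Sum>p | p permutes S. of_int (sign p) * (G p - P p - \<epsilon> * L p))"
    by (simp add: sum_subtractf sum.distrib sum_distrib_left algebra_simps)
  also have "\<bar>\<dots>\<bar> \<le> (\<Sum>p | p permutes S. \<bar>of_int (sign p) * (G p - P p - \<epsilon> * L p)\<bar>)"
    by (rule sum_abs)
  also have "\<dots> \<le> (\<Sum>p | p permutes S. (3 * K) ^ card S * \<epsilon>\<^sup>2)"
  proof (rule sum_mono)
    fix p
    have "\<forall>i\<in>S. \<bar>a p i\<bar> \<le> K \<and> \<bar>b p i\<bar> \<le> K" using K d M by (auto simp: a_def b_def diag_def)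
    from prod_perturbation[OF _ K e this]
    show "\<bar>of_int (sign p) * (G p - P p - \<epsilon> * L p)\<bar> \<le> (3 * K) ^ card S * \<epsilon>\<^sup>2"
      by (simp add: G_def P_def L_def abs_mult sign_def)
  qed
  finally show ?thesis by (simp add: mult.assoc)
qed

text \<open>The derivative of \<open>\<sigma>\<^sub>j\<close> in its \<open>i\<close>-th argument is
  \<open>\<sigma>\<^sub>j\<^sub>-\<^sub>1\<close> without that argument. The constant depends on the
  bound \<open>K\<close> but not on \<open>d\<close> or \<open>M\<close>: the barriers need the
  estimate uniformly over the domain.\<close>

lemma msym_perturbation:
  fixes K :: real
  assumes K: "K \<ge> 0" and j: "j \<ge> 1"
  obtains C where "C \<ge> 0" "\<And>\<epsilon> (d :: real^'n::finite) M. \<bar>\<epsilon>\<bar> \<le> 1 \<Longrightarrow> (\<And>i. \<bar>d $ i\<bar> \<le> K) \<Longrightarrow> (\<And>i j. \<bar>M $ i $ j\<bar> \<le> K) \<Longrightarrow>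
     \<bar>msym j (diag d + \<epsilon> *\<^sub>R M) - elem_sym j d - \<epsilon> * (\<Sum>i\<in>UNIV. M $ i $ i * esym (UNIV - {i}) (j - 1) (($) d))\<bar> \<le> C * \<epsilon>\<^sup>2"
proof
  define C where "C = (\<Sum>S | card (S :: 'n set) = j. real (card {p. p permutes S}) * (3 * K) ^ card S)"
  show "C \<ge> 0" unfolding C_def using K by (intro sum_nonneg) auto
  fix \<epsilon> :: real and d :: "real^'n" and M :: "real^'n^'n"
  assume e: "\<bar>\<epsilon>\<bar> \<le> 1" and d: "\<And>i. \<bar>d $ i\<bar> \<le> K" and M: "\<And>i j. \<bar>M $ i $ j\<bar> \<le> K"
  let ?F = "{S :: 'n set. card S = j}"
  have "(\<Sum>S\<in>?F. \<Sum>i\<in>S. M $ i $ i * (\<Prod>l\<in>S-{i}. d $ l))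
    = (\<Sum>S\<in>?F. \<Sum>i\<in>UNIV. if i \<in> S then M $ i $ i * (\<Prod>l\<in>S-{i}. d $ l) else 0)"
    by (simp flip: sum.inter_filter)
  also have "\<dots> = (\<Sum>i\<in>UNIV. \<Sum>S\<in>?F. if i \<in> S then M $ i $ i * (\<Prod>l\<in>S-{i}. d $ l) else 0)"
    by (rule sum.swap)
  also have "\<dots> = (\<Sum>i\<in>UNIV. M $ i $ i * esym (UNIV - {i}) (j - 1) (($) d))"
  proof (rule sum.cong)
    fix i :: 'n
    have "(\<Sum>S\<in>?F. if i \<in> S then M $ i $ i * (\<Prod>l\<in>S-{i}. d $ l) else 0)
       = (\<Sum>S\<in>{S\<in>?F. i \<in> S}. M $ i $ i * (\<Prod>l\<in>S-{i}. d $ l))"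
      by (rule sum.inter_filter[symmetric]) simp
    also have "\<dots> = (\<Sum>T | T \<subseteq> UNIV - {i} \<and> card T = j - 1. M $ i $ i * (\<Prod>l\<in>T. d $ l))"
    proof (rule sum.reindex_bij_witness[of _ "insert i" "\<lambda>S. S - {i}"])
      fix T :: "'n set" assume T: "T \<in> {T. T \<subseteq> UNIV - {i} \<and> card T = j - 1}"
      then have "i \<notin> T" by auto
      then show "insert i T - {i} = T" "insert i T \<in> {S\<in>?F. i \<in> S}"
        using T j by auto
    qed (use j in auto)
    finally show "(\<Sum>S\<in>?F. if i \<in> S then M $ i $ i * (\<Prod>l\<in>S-{i}. d $ l) else 0) = M $ i $ i * esym (UNIV - {i}) (j - 1) (($) d)"
      by (simp add: esym_def sum_distrib_left)
  qed simp
  finally have eq: "(\<Sum>i\<in>UNIV. M $ i $ i * esym (UNIV - {i}) (j - 1) (($) d)) = (\<Sum>S\<in>?F. \<Sum>i\<in>S. M $ i $ i * (\<Prod>l\<in>S-{i}. d $ l))" ..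
  have "msym j (diag d + \<epsilon> *\<^sub>R M) - elem_sym j d - \<epsilon> * (\<Sum>i\<in>UNIV. M $ i $ i * esym (UNIV - {i}) (j - 1) (($) d))
    = (\<Sum>S\<in>?F. pminor S (diag d + \<epsilon> *\<^sub>R M) - (\<Prod>i\<in>S. d $ i) - \<epsilon> * (\<Sum>i\<in>S. M $ i $ i * (\<Prod>l\<in>S-{i}. d $ l)))"
    unfolding eq by (simp add: msym_def elem_sym_def sum_subtractf sum_distrib_left)
  also have "\<bar>\<dots>\<bar> \<le> (\<Sum>S\<in>?F. \<bar>pminor S (diag d + \<epsilon> *\<^sub>R M) - (\<Prod>i\<in>S. d $ i) - \<epsilon> * (\<Sum>i\<in>S. M $ i $ i * (\<Prod>l\<in>S-{i}. d $ l))\<bar>)"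
    by (rule sum_abs)
  also have "\<dots> \<le> (\<Sum>S\<in>?F. real (card {p. p permutes S}) * (3 * K) ^ card S * \<epsilon>\<^sup>2)"
    by (intro sum_mono pminor_perturbation K e d M)
  finally show "\<bar>msym j (diag d + \<epsilon> *\<^sub>R M) - elem_sym j d - \<epsilon> * (\<Sum>i\<in>UNIV. M $ i $ i * esym (UNIV - {i}) (j - 1) (($) d))\<bar> \<le> C * \<epsilon>\<^sup>2"
    by (simp add: C_def sum_distrib_right)
qed

lemma msym_scaleR: "msym j (c *\<^sub>R A) = c ^ j * msym j A"
  by (auto simp: msym_def pminor_def prod.distrib sum_distrib_left mult_ac intro!: sum.cong)

lemma conj_diag_entry:
  "(transpose Q ** N ** Q) $ i $ i = column i Q \<bullet> (N *v column i Q)"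
  for Q N :: "real^'n^'n::finite"
proof -
  have "(transpose Q ** (N ** Q)) $ i $ i = column i Q \<bullet> column i (N ** Q)"
    by (simp add: matrix_matrix_mult_def inner_vec_def column_def transpose_def)
  also have "column i (N ** Q) = N *v column i Q"
    by (simp add: vec_eq_iff matrix_matrix_mult_def matrix_vector_mult_def column_def)
  finally show ?thesis by (simp add: matrix_mul_assoc)
qed

lemma orthogonal_conj_add:
  fixes Q A N :: "real^'n^'n::finite"
  assumes "orthogonal_matrix Q" "A = Q ** D ** transpose Q"
  shows "A + \<tau> *\<^sub>R N = Q ** (D + \<tau> *\<^sub>R (transpose Q ** N ** Q)) ** transpose Q"
proof -
  have QQ: "Q ** transpose Q = mat 1" using assms by (simp add: orthogonal_matrix_def)
  have "Q ** (transpose Q ** N ** Q) ** transpose Q = (Q ** transpose Q) ** N ** (Q ** transpose Q)"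
    by (simp only: matrix_mul_assoc)
  then have "Q ** (transpose Q ** N ** Q) ** transpose Q = N" by (simp add: QQ)
  then show ?thesis
    by (simp add: assms(2) matrix_add_ldistrib matrix_add_mult_distrib matrix_scalar_ac flip: scalar_matrix_assoc)
qed

text \<open>In an eigenbasis of \<open>A\<close> the expansion is around a diagonal matrix, and its
  remainder is quadratic in \<open>\<tau>\<close>.\<close>

lemma msym_has_derivative_along:
  fixes A N Q :: "real^'n^'n::finite"
  assumes Q: "orthogonal_matrix Q" and A: "A = Q ** diag d ** transpose Q" and j: "j \<ge> 1"
  shows "((\<lambda>\<tau>. msym j (A + \<tau> *\<^sub>R N)) has_real_derivative
     (\<Sum>i\<in>UNIV. (column i Q \<bullet> (N *v column i Q)) * esym (UNIV - {i}) (j - 1) (($) d))) (at 0)"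
proof -
  define M where "M = transpose Q ** N ** Q"
  define L where "L = (\<Sum>i\<in>UNIV. M $ i $ i * esym (UNIV - {i}) (j - 1) (($) d))"
  have conj: "msym j (A + \<tau> *\<^sub>R N) = msym j (diag d + \<tau> *\<^sub>R M)" for \<tau>
    unfolding M_def using orthogonal_conj_add[OF Q A] msym_similar[OF Q] by metis
  define K where "K = (\<Sum>i\<in>UNIV. \<bar>d $ i\<bar>) + (\<Sum>i\<in>UNIV. \<Sum>j\<in>UNIV. \<bar>M $ i $ j\<bar>)"
  have K: "K \<ge> 0" by (simp add: K_def sum_nonneg)
  have d: "\<bar>d $ i\<bar> \<le> K" for i
    unfolding K_def by (intro add_increasing2 sum_nonneg member_le_sum) auto
  have M: "\<bar>M $ i $ l\<bar> \<le> K" for i l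
  proof -
    have "\<bar>M $ i $ l\<bar> \<le> (\<Sum>j\<in>UNIV. \<bar>M $ i $ j\<bar>)" by (intro member_le_sum) auto
    also have "\<dots> \<le> (\<Sum>i\<in>UNIV. \<Sum>j\<in>UNIV. \<bar>M $ i $ j\<bar>)"
      by (intro member_le_sum[where f = "\<lambda>i. \<Sum>j\<in>UNIV. \<bar>M $ i $ j\<bar>"]) (auto intro: sum_nonneg)
    finally show ?thesis unfolding K_def by (simp add: add_increasing sum_nonneg)
  qed
  obtain C where "C \<ge> 0" and
    CC: "\<And>\<epsilon> (d :: real^'n) M. \<bar>\<epsilon>\<bar> \<le> 1 \<Longrightarrow> (\<And>i. \<bar>d $ i\<bar> \<le> K) \<Longrightarrow> (\<And>i j. \<bar>M $ i $ j\<bar> \<le> K) \<Longrightarrow>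
     \<bar>msym j (diag d + \<epsilon> *\<^sub>R M) - elem_sym j d - \<epsilon> * (\<Sum>i\<in>UNIV. M $ i $ i * esym (UNIV - {i}) (j - 1) (($) d))\<bar> \<le> C * \<epsilon>\<^sup>2"
    using msym_perturbation[OF K j] by blast
  have C: "C \<ge> 0" "\<And>\<epsilon>. \<bar>\<epsilon>\<bar> \<le> 1 \<Longrightarrow> \<bar>msym j (diag d + \<epsilon> *\<^sub>R M) - elem_sym j d - \<epsilon> * L\<bar> \<le> C * \<epsilon>\<^sup>2"
    unfolding L_def by (fact, rule CC) (simp_all add: d M)
  have f0: "msym j (A + 0 *\<^sub>R N) = elem_sym j d" unfolding conj by (simp add: msym_diag)
  have "((\<lambda>\<tau>. msym j (A + \<tau> *\<^sub>R N)) has_real_derivative L) (at 0)"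
    unfolding has_field_derivative_iff
  proof (rule LIM_I)
    fix r :: real assume "r > 0"
    \<comment> \<open>\<open>C + 1\<close> instead of \<open>C\<close> keeps the quotient positive
      when \<open>C = 0\<close>.\<close>
    define s where "s = min 1 (r / (C + 1))"
    show "\<exists>s>0. \<forall>x. x \<noteq> 0 \<and> norm (x - 0) < s \<longrightarrow>
      norm ((msym j (A + x *\<^sub>R N) - msym j (A + 0 *\<^sub>R N)) / (x - 0) - L) < r"
    proof (intro exI[of _ s] conjI allI impI)
      show "s > 0" using \<open>r > 0\<close> C(1) by (simp add: s_def)
      fix x :: real assume x: "x \<noteq> 0 \<and> norm (x - 0) < s"
      then have "\<bar>x\<bar> \<le> 1" by (simp add: s_def)
      have "(msym j (A + x *\<^sub>R N) - msym j (A + 0 *\<^sub>R N)) / (x - 0) - L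
        = (msym j (diag d + x *\<^sub>R M) - elem_sym j d - x * L) / x"
        using x f0 by (simp add: conj[of x] diff_divide_distrib)
      then have "norm ((msym j (A + x *\<^sub>R N) - msym j (A + 0 *\<^sub>R N)) / (x - 0) - L) \<le> C * x\<^sup>2 / \<bar>x\<bar>"
        using C(2)[OF \<open>\<bar>x\<bar> \<le> 1\<close>] by (simp add: divide_right_mono)
      also have "\<dots> = C * \<bar>x\<bar>"
        using x by (cases "x > 0") (auto simp: power2_eq_square)
      also have "\<dots> \<le> (C + 1) * \<bar>x\<bar>" by (simp add: algebra_simps)
      also have "\<dots> < r"
      proof -
        have "\<bar>x\<bar> < r / (C + 1)" using x by (simp add: s_def)
        then show ?thesis using C(1) by (simp add: pos_less_divide_eq mult.commute)
      qed
      finally show "norm ((msym j (A + x *\<^sub>R N) - msym j (A + 0 *\<^sub>R N)) / (x - 0) - L) < r" .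
    qed
  qed
  then show ?thesis by (simp add: L_def M_def conj_diag_entry)
qed

section \<open>Monotonicity on the Garding cone\<close>

text \<open>For symmetric matrices this says that the eigenvalues lie in
  \<open>Garding_cone k\<close>; in terms of \<open>msym\<close> the conditions are polynomial along
  segments of matrices.\<close>

definition garding :: "nat \<Rightarrow> real^'n^'n::finite \<Rightarrow> bool" where
  "garding k A \<longleftrightarrow> (\<forall>j. 1 \<le> j \<and> j \<le> k \<longrightarrow> msym j A > 0)"

lemma transpose_add: "transpose (A + B) = transpose A + transpose B"
  and transpose_diff: "transpose (A - B) = transpose A - transpose B"
  for A B :: "real^'n^'m"
  by (simp_all add: vec_eq_iff transpose_def)

text \<open>The weights \<open>esym (UNIV - {i}) (j - 1)\<close> are nonnegative by
  \<open>esym_delete_nonneg\<close>. Only the sign is tied to the cone, so that \<open>msym\<close>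
  can be differentiated at parameters where membership is still open.\<close>

lemma msym_derivative_nonneg:
  fixes A N :: "real^'n^'n::finite"
  assumes A: "transpose A = A" and N: "\<And>v. v \<bullet> (N *v v) \<ge> 0"
    and j: "1 \<le> j" "j \<le> CARD('n)"
  obtains D where "((\<lambda>\<tau>. msym j (A + \<tau> *\<^sub>R N)) has_real_derivative D) (at 0)"
    "garding j A \<Longrightarrow> D \<ge> 0"
proof -
  obtain Q d where Q: "orthogonal_matrix Q" and Ad: "A = Q ** diag d ** transpose Q"
    using symmetric_diagonalizable[OF A] by blast
  define D where "D = (\<Sum>i\<in>UNIV. (column i Q \<bullet> (N *v column i Q)) * esym (UNIV - {i}) (j - 1) (($) d))"
  have "D \<ge> 0" if g: "garding j A"
  proof -
    have "esym UNIV l (($) d) > 0" if "1 \<le> l" "l \<le> j" for l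
    proof -
      have "msym l A = esym UNIV l (($) d)"
        unfolding Ad msym_similar[OF Q] msym_diag by (rule elem_sym_eq_esym)
      then show ?thesis using g that by (auto simp: garding_def)
    qed
    then have "esym (UNIV - {i}) (j - 1) (($) d) \<ge> 0" for i
      using j by (intro esym_delete_nonneg) auto
    then show ?thesis unfolding D_def using N by (intro sum_nonneg mult_nonneg_nonneg) auto
  qed
  then show ?thesis using msym_has_derivative_along[OF Q Ad j(1), of N] that by (simp add: D_def)
qed

text \<open>The derivative along the segment is nonnegative only inside the cone; that the segment stays in
  the cone follows by looking at the first parameter at which some \<open>\<sigma>\<^sub>j\<close> with \<open>j \<le> k\<close> fails to be positive.\<close>

theorem msym_mono:
  fixes A N :: "real^'n^'n::finite"
  assumes A: "transpose A = A" and Ns: "transpose N = N" and N: "\<And>v. v \<bullet> (N *v v) \<ge> 0"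
    and g: "garding k A" and k: "1 \<le> k" "k \<le> CARD('n)"
  shows "msym k A \<le> msym k (A + N)"
proof -
  define G where "G j \<tau> = msym j (A + \<tau> *\<^sub>R N)" for j \<tau>
  have sym: "transpose (A + \<tau> *\<^sub>R N) = A + \<tau> *\<^sub>R N" for \<tau>
    by (simp add: transpose_add A Ns transpose_scalar)
  have "\<exists>D. (G j has_real_derivative D) (at \<tau>) \<and> (garding j (A + \<tau> *\<^sub>R N) \<longrightarrow> D \<ge> 0)"
    if jk: "1 \<le> j" "j \<le> k" for j \<tau>
  proof -
    obtain D where D: "((\<lambda>s. msym j (A + \<tau> *\<^sub>R N + s *\<^sub>R N)) has_real_derivative D) (at 0)"
      "garding j (A + \<tau> *\<^sub>R N) \<Longrightarrow> D \<ge> 0"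
      using msym_derivative_nonneg[OF sym N jk(1) le_trans[OF jk(2) k(2)], of \<tau>] by blast
    have eq: "(\<lambda>s. msym j (A + \<tau> *\<^sub>R N + s *\<^sub>R N)) = (\<lambda>s. G j (s + \<tau>))"
      by (auto simp: G_def scaleR_add_left algebra_simps)
    have "(G j has_real_derivative D) (at (0 + \<tau>))" using D(1) unfolding eq DERIV_shift .
    then show ?thesis using D(2) by auto
  qed
  then obtain D where D: "\<And>j \<tau>. 1 \<le> j \<Longrightarrow> j \<le> k \<Longrightarrow> (G j has_real_derivative D j \<tau>) (at \<tau>)"
    "\<And>j \<tau>. 1 \<le> j \<Longrightarrow> j \<le> k \<Longrightarrow> garding j (A + \<tau> *\<^sub>R N) \<Longrightarrow> D j \<tau> \<ge> 0"
    by metis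
  have cont: "continuous_on S (G j)" if "1 \<le> j" "j \<le> k" for j S
    using D(1)[OF that] by (meson DERIV_isCont continuous_at_imp_continuous_on)
  \<comment> \<open>Membership in the cone is asked for strictly between the ends only, because at
    \<open>\<tau>\<close> it is what is in doubt.\<close>
  have mono: "G j 0 \<le> G j \<tau>" if j: "1 \<le> j" "j \<le> k" and t: "0 \<le> \<tau>"
    and pos: "\<And>s. 0 < s \<Longrightarrow> s < \<tau> \<Longrightarrow> garding k (A + s *\<^sub>R N)" for j \<tau>
  proof (cases "\<tau> = 0")
    case False
    show ?thesis
    proof (rule DERIV_nonneg_imp_increasing_open[OF t])
      fix x assume x: "0 < x" "x < \<tau>"
      have "garding j (A + x *\<^sub>R N)" using pos[OF x] j by (auto simp: garding_def)
      then show "\<exists>y. (G j has_real_derivative y) (at x) \<and> 0 \<le> y" using D j by blast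
    qed (rule cont[OF j])
  qed simp
  \<comment> \<open>\<open>T\<close> is the compact set of parameters where some
    \<open>\<sigma>\<^sub>j\<close> fails. Before its least element the segment lies in the cone, so
    by monotonicity the failing \<open>\<sigma>\<^sub>j\<close> would already be nonpositive at
    parameter 0.\<close>
  define T where "T = (\<Union>j\<in>{1..k}. {0..1} \<inter> {\<tau>. G j \<tau> \<le> 0})"
  have "T = {}"
  proof (rule ccontr)
    assume "T \<noteq> {}"
    moreover have "compact T" unfolding T_def
    proof (intro compact_UN)
      fix j assume j: "j \<in> {1..k}"
      have "closed {\<tau>. G j \<tau> \<le> 0}"
        using cont[of j UNIV] j by (intro closed_Collect_le) auto
      then show "compact ({0..1} \<inter> {\<tau>. G j \<tau> \<le> 0})" by (intro compact_Int_closed) auto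
    qed simp
    ultimately obtain \<tau> where \<tau>: "\<tau> \<in> T" "\<And>s. s \<in> T \<Longrightarrow> \<tau> \<le> s"
      using compact_attains_inf by metis
    then obtain j where j: "1 \<le> j" "j \<le> k" "0 \<le> \<tau>" "\<tau> \<le> 1" "G j \<tau> \<le> 0" by (auto simp: T_def)
    have "garding k (A + s *\<^sub>R N)" if "0 < s" "s < \<tau>" for s
    proof -
      have "s \<notin> T" using \<tau>(2)[of s] that by linarith
      then show ?thesis using that j(4) by (auto simp: T_def garding_def G_def not_le)
    qed
    from mono[OF j(1,2,3) this] have "G j 0 \<le> 0" using j(5) by linarith
    then show False using g j by (auto simp: garding_def G_def)
  qed
  have "garding k (A + s *\<^sub>R N)" if "0 < s" "s < 1" for s
  proof -
    have "s \<notin> T" using \<open>T = {}\<close> by simp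
    then show ?thesis using that by (auto simp: T_def garding_def G_def not_le)
  qed
  from mono[OF k(1) order_refl zero_le_one this] show ?thesis by (simp add: G_def)
qed

section \<open>Calculus of iterated partial derivatives\<close>

lemma partial_deriv_cong_open:
  assumes "open W" "x \<in> W" and eq: "\<And>y. y \<in> W \<Longrightarrow> f y = g y"
  shows "partial_deriv i f x = partial_deriv i g x"
proof -
  \<comment> \<open>The choice inside \<open>frechet_derivative\<close> then ranges over the same
    maps on both sides, even if there are none.\<close>
  have "(f has_derivative D) (at x) \<longleftrightarrow> (g has_derivative D) (at x)" for D
    using has_derivative_transform_within_open[OF _ assms(1,2), of _ _ UNIV] eq by metis
  then show ?thesis by (simp add: partial_deriv_def frechet_derivative_def)
qed

lemma partial_deriv_lincomb:
  assumes "f differentiable at x" "g differentiable at x"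
  shows "partial_deriv i (\<lambda>x. a * f x + b * g x) x = a * partial_deriv i f x + b * partial_deriv i g x"
proof -
  have "((\<lambda>x. a * f x + b * g x) has_derivative
      (\<lambda>v. a * frechet_derivative f (at x) v + b * frechet_derivative g (at x) v)) (at x)"
    using assms unfolding frechet_derivative_works by (intro derivative_intros)
  from frechet_derivative_at[OF this] show ?thesis by (simp add: partial_deriv_def fun_eq_iff)
qed

lemma iter_partial_lincomb:
  assumes W: "open W" and f: "smooth_on_open W f" and g: "smooth_on_open W g" and "x \<in> W"
  shows "iter_partial ds (\<lambda>x. a * f x + b * g x) x = a * iter_partial ds f x + b * iter_partial ds g x"
  using assms(4)
proof (induction ds arbitrary: x)
  case (Cons i ds)
  have "iter_partial (i # ds) (\<lambda>x. a * f x + b * g x) x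
     = partial_deriv i (\<lambda>x. a * iter_partial ds f x + b * iter_partial ds g x) x"
    using partial_deriv_cong_open[OF W Cons.prems Cons.IH] by simp
  also have "\<dots> = a * iter_partial (i # ds) f x + b * iter_partial (i # ds) g x"
    using f g Cons.prems by (subst partial_deriv_lincomb) (auto simp: smooth_on_open_def)
  finally show ?case .
qed simp

lemma smooth_on_open_lincomb:
  assumes W: "open W" and f: "smooth_on_open W f" and g: "smooth_on_open W g"
  shows "smooth_on_open W (\<lambda>x. a * f x + b * g x)"
  unfolding smooth_on_open_def
proof (intro allI ballI)
  fix ds x assume x: "x \<in> W"
  obtain F G where "(iter_partial ds f has_derivative F) (at x)" "(iter_partial ds g has_derivative G) (at x)"
    using f g x unfolding smooth_on_open_def differentiable_def by metis
  then have "((\<lambda>x. a * iter_partial ds f x + b * iter_partial ds g x) has_derivative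
      (\<lambda>v. a * F v + b * G v)) (at x)"
    by (intro derivative_intros)
  then have "(iter_partial ds (\<lambda>x. a * f x + b * g x) has_derivative (\<lambda>v. a * F v + b * G v)) (at x)"
    by (rule has_derivative_transform_within_open[OF _ W x]) (simp add: iter_partial_lincomb[OF assms])
  then show "iter_partial ds (\<lambda>x. a * f x + b * g x) differentiable (at x)"
    unfolding differentiable_def by blast
qed

lemma smooth_up_to_boundary_lincomb:
  assumes W: "open \<Omega>" and f: "smooth_up_to_boundary \<Omega> f" and g: "smooth_up_to_boundary \<Omega> g"
  shows "smooth_up_to_boundary \<Omega> (\<lambda>x. a * f x + b * g x)"
  unfolding smooth_up_to_boundary_def
proof (intro conjI allI)
  have sf: "smooth_on_open \<Omega> f" and sg: "smooth_on_open \<Omega> g"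
    using f g by (auto simp: smooth_up_to_boundary_def)
  then show "smooth_on_open \<Omega> (\<lambda>x. a * f x + b * g x)" by (intro smooth_on_open_lincomb W)
  show "continuous_on (closure \<Omega>) (\<lambda>x. a * f x + b * g x)"
    using f g by (auto simp: smooth_up_to_boundary_def intro!: continuous_intros)
  fix ds
  obtain F where F: "continuous_on (closure \<Omega>) F" "\<forall>x\<in>\<Omega>. F x = iter_partial ds f x"
    using f by (auto simp: smooth_up_to_boundary_def)
  obtain G where G: "continuous_on (closure \<Omega>) G" "\<forall>x\<in>\<Omega>. G x = iter_partial ds g x"
    using g by (auto simp: smooth_up_to_boundary_def)
  show "\<exists>h. continuous_on (closure \<Omega>) h \<and> (\<forall>x\<in>\<Omega>. h x = iter_partial ds (\<lambda>x. a * f x + b * g x) x)"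
    using F G by (intro exI[of _ "\<lambda>x. a * F x + b * G x"])
      (auto simp: iter_partial_lincomb[OF W sf sg] intro!: continuous_intros)
qed

lemma hessian_lincomb:
  assumes "open \<Omega>" "smooth_up_to_boundary \<Omega> f" "smooth_up_to_boundary \<Omega> g" "x \<in> \<Omega>"
  shows "hessian (\<lambda>x. a * f x + b * g x) x = a *\<^sub>R hessian f x + b *\<^sub>R hessian g x"
  using iter_partial_lincomb[OF assms(1) _ _ assms(4), of f g] assms(2,3)
  by (simp add: hessian_def vec_eq_iff smooth_up_to_boundary_def del: iter_partial.simps)

section \<open>Smoothness of quadratic functions\<close>

text \<open>A class containing \<open>\<phi> E\<close> and closed under partial derivatives, so that
  smoothness follows by induction.\<close>

definition quadratic_function :: "(real^'n::finite \<Rightarrow> real) \<Rightarrow> bool" where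
  "quadratic_function g \<longleftrightarrow> (\<exists>B b c. g = (\<lambda>x. x \<bullet> (B *v x) + b \<bullet> x + c))"

lemma quadratic_has_derivative:
  fixes B :: "real^'n^'n::finite"
  shows "((\<lambda>x. x \<bullet> (B *v x) + b \<bullet> x + c) has_derivative (\<lambda>v. x \<bullet> (B *v v) + v \<bullet> (B *v x) + b \<bullet> v)) (at x)"
proof -
  have "((*v) B has_derivative (*v) B) (at x)"
    by (rule bounded_linear_imp_has_derivative[OF matrix_vector_mul_bounded_linear])
  from has_derivative_inner[OF has_derivative_ident this]
  have "((\<lambda>x. x \<bullet> (B *v x)) has_derivative (\<lambda>v. x \<bullet> (B *v v) + v \<bullet> (B *v x))) (at x)" .
  then have "((\<lambda>x. x \<bullet> (B *v x) + b \<bullet> x + c) has_derivative (\<lambda>v. (x \<bullet> (B *v v) + v \<bullet> (B *v x)) + b \<bullet> v + 0)) (at x)"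
    by (intro has_derivative_add has_derivative_const has_derivative_inner_right has_derivative_ident)
  then show ?thesis by simp
qed

lemma partial_deriv_quadratic:
  fixes B :: "real^'n^'n::finite"
  shows "partial_deriv i (\<lambda>x. x \<bullet> (B *v x) + b \<bullet> x + c)
    = (\<lambda>x. (transpose B *v axis i 1 + B *v axis i 1) \<bullet> x + b \<bullet> axis i 1)"
proof
  fix x
  have "partial_deriv i (\<lambda>x. x \<bullet> (B *v x) + b \<bullet> x + c) x = x \<bullet> (B *v axis i 1) + axis i 1 \<bullet> (B *v x) + b \<bullet> axis i 1"
    unfolding partial_deriv_def frechet_derivative_at[OF quadratic_has_derivative, symmetric] ..
  moreover have "axis i 1 \<bullet> (B *v x) = (transpose B *v axis i 1) \<bullet> x"
    by (simp add: dot_lmul_matrix)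
  ultimately show "partial_deriv i (\<lambda>x. x \<bullet> (B *v x) + b \<bullet> x + c) x
    = (transpose B *v axis i 1 + B *v axis i 1) \<bullet> x + b \<bullet> axis i 1"
    by (simp add: inner_add_left inner_add_right inner_commute)
qed

lemma quadratic_iter_partial:
  assumes "quadratic_function g"
  shows "quadratic_function (iter_partial ds g)"
proof (induction ds)
  case (Cons i ds)
  then obtain B b c where "iter_partial ds g = (\<lambda>x. x \<bullet> (B *v x) + b \<bullet> x + c)"
    unfolding quadratic_function_def by blast
  then have "iter_partial (i # ds) g = (\<lambda>x. x \<bullet> (0 *v x) + (transpose B *v axis i 1 + B *v axis i 1) \<bullet> x + b \<bullet> axis i 1)"
    by (simp add: partial_deriv_quadratic)
  then show ?case unfolding quadratic_function_def by blast
qed (use assms in simp)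

lemma quadratic_differentiable: "quadratic_function g \<Longrightarrow> g differentiable (at x)"
  using quadratic_has_derivative unfolding quadratic_function_def differentiable_def by blast

lemma quadratic_smooth_up_to_boundary:
  assumes "quadratic_function g"
  shows "smooth_up_to_boundary \<Omega> g"
proof -
  have d: "iter_partial ds g differentiable (at x)" for ds x
    by (intro quadratic_differentiable quadratic_iter_partial assms)
  then have "continuous_on (closure \<Omega>) (iter_partial ds g)" for ds
    by (meson continuous_at_imp_continuous_on differentiable_imp_continuous_within)
  from this this[of "[]"] show ?thesis
    unfolding smooth_up_to_boundary_def smooth_on_open_def using d by auto
qed

section \<open>Symmetry of the Hessian and the maximum principle\<close>

lemma has_real_derivative_along:
  assumes "g differentiable (at (a + s *\<^sub>R v))"
  shows "((\<lambda>s. g (a + s *\<^sub>R v)) has_real_derivative frechet_derivative g (at (a + s *\<^sub>R v)) v) (at s)"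
proof -
  let ?D = "frechet_derivative g (at (a + s *\<^sub>R v))"
  have D: "(g has_derivative ?D) (at (a + s *\<^sub>R v))" using assms by (simp add: frechet_derivative_works)
  have "((\<lambda>s. a + s *\<^sub>R v) has_derivative (\<lambda>h. h *\<^sub>R v)) (at s)"
    by (auto intro!: derivative_eq_intros)
  from has_derivative_compose[OF this D]
  have "((\<lambda>s. g (a + s *\<^sub>R v)) has_derivative (\<lambda>h. ?D (h *\<^sub>R v))) (at s)" .
  moreover have "?D (h *\<^sub>R v) = h * ?D v" for h
    using has_derivative_linear[OF D] by (simp add: linear_cmul)
  ultimately show ?thesis by (simp add: has_field_derivative_def mult_commute_abs)
qed

lemma frechet_derivative_eq_partials:
  fixes g :: "real^'n::finite \<Rightarrow> real"
  assumes "g differentiable (at x)"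
  shows "frechet_derivative g (at x) v = (\<Sum>i\<in>UNIV. v $ i * partial_deriv i g x)"
proof -
  have lin: "linear (frechet_derivative g (at x))"
    using assms by (simp add: frechet_derivative_works has_derivative_linear)
  have "v = (\<Sum>i\<in>UNIV. v $ i *\<^sub>R axis i 1)" by (simp add: basis_expansion scalar_mult_eq_scaleR[symmetric])
  then have "frechet_derivative g (at x) v = frechet_derivative g (at x) (\<Sum>i\<in>UNIV. v $ i *\<^sub>R axis i 1)"
    by simp
  also have "\<dots> = (\<Sum>i\<in>UNIV. v $ i * partial_deriv i g x)"
    by (simp add: linear_sum[OF lin] linear_cmul[OF lin] partial_deriv_def)
  finally show ?thesis .
qed

text \<open>The mean value theorem is applied twice: in direction \<open>i\<close> to the difference
  \<open>p\<close> between two parallel lines, then in direction \<open>j\<close> to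
  \<open>partial_deriv i g\<close>. The radius \<open>2 * h\<close> covers all points reached by
  steps of at most \<open>h\<close> in both directions.\<close>

lemma mixed_difference_mean_value:
  fixes g :: "real^'n::finite \<Rightarrow> real"
  assumes sub: "cball x (2 * h) \<subseteq> W" and g: "smooth_on_open W g" and h: "h > 0"
  obtains y where "y \<in> cball x (2 * h)"
    "g (x + h *\<^sub>R axis i 1 + h *\<^sub>R axis j 1) - g (x + h *\<^sub>R axis i 1) - g (x + h *\<^sub>R axis j 1) + g x
      = h\<^sup>2 * iter_partial [j, i] g y"
proof -
  let ?e = "axis i 1 :: real^'n" and ?f = "axis j 1 :: real^'n"
  have inW: "x + s *\<^sub>R ?e + t *\<^sub>R ?f \<in> cball x (2 * h)" if "0 \<le> s" "s \<le> h" "0 \<le> t" "t \<le> h" for s t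
  proof -
    have "norm (s *\<^sub>R ?e + t *\<^sub>R ?f) \<le> norm (s *\<^sub>R ?e) + norm (t *\<^sub>R ?f)" by (rule norm_triangle_ineq)
    also have "\<dots> \<le> 2 * h" using that by simp
    finally have "norm (- (s *\<^sub>R ?e + t *\<^sub>R ?f)) \<le> 2 * h" by (simp only: norm_minus_cancel)
    then show ?thesis by (simp add: dist_norm)
  qed
  have d0: "g differentiable (at z)" and d1: "partial_deriv i g differentiable (at z)" if "z \<in> cball x (2 * h)" for z
  proof -
    have "iter_partial ds g differentiable (at z)" for ds
      using g sub that unfolding smooth_on_open_def by blast
    from this[of "[]"] this[of "[i]"]
    show "g differentiable (at z)" "partial_deriv i g differentiable (at z)" by simp_all
  qed
  define p where "p s = g (x + h *\<^sub>R ?f + s *\<^sub>R ?e) - g (x + s *\<^sub>R ?e)" for s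
  have "\<exists>\<xi>>0. \<xi> < h \<and> p h - p 0 = (h - 0) * (partial_deriv i g (x + h *\<^sub>R ?f + \<xi> *\<^sub>R ?e) - partial_deriv i g (x + \<xi> *\<^sub>R ?e))"
  proof (rule MVT2[OF h])
    fix s assume s: "0 \<le> s" "s \<le> h"
    have 1: "x + h *\<^sub>R ?f + s *\<^sub>R ?e \<in> cball x (2 * h)" using inW[of s h] s h by (simp add: algebra_simps)
    have 2: "x + s *\<^sub>R ?e \<in> cball x (2 * h)" using inW[of s 0] s h by simp
    show "DERIV p s :> partial_deriv i g (x + h *\<^sub>R ?f + s *\<^sub>R ?e) - partial_deriv i g (x + s *\<^sub>R ?e)"
      unfolding p_def partial_deriv_def
      by (intro DERIV_diff has_real_derivative_along d0 1 2)
  qed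
  then obtain \<xi> where \<xi>: "0 < \<xi>" "\<xi> < h"
    "p h - p 0 = h * (partial_deriv i g (x + \<xi> *\<^sub>R ?e + h *\<^sub>R ?f) - partial_deriv i g (x + \<xi> *\<^sub>R ?e))"
    by (auto simp: algebra_simps)
  have "\<exists>\<eta>>0. \<eta> < h \<and> partial_deriv i g (x + \<xi> *\<^sub>R ?e + h *\<^sub>R ?f) - partial_deriv i g (x + \<xi> *\<^sub>R ?e + 0 *\<^sub>R ?f)
    = (h - 0) * partial_deriv j (partial_deriv i g) (x + \<xi> *\<^sub>R ?e + \<eta> *\<^sub>R ?f)"
  proof (rule MVT2[OF h])
    fix t assume t: "0 \<le> t" "t \<le> h"
    show "DERIV (\<lambda>t. partial_deriv i g (x + \<xi> *\<^sub>R ?e + t *\<^sub>R ?f)) t :> partial_deriv j (partial_deriv i g) (x + \<xi> *\<^sub>R ?e + t *\<^sub>R ?f)"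
      unfolding partial_deriv_def[of j]
      by (intro has_real_derivative_along d1 inW) (use t \<xi> in auto)
  qed
  then obtain \<eta> where \<eta>: "0 < \<eta>" "\<eta> < h"
    "partial_deriv i g (x + \<xi> *\<^sub>R ?e + h *\<^sub>R ?f) - partial_deriv i g (x + \<xi> *\<^sub>R ?e)
       = h * partial_deriv j (partial_deriv i g) (x + \<xi> *\<^sub>R ?e + \<eta> *\<^sub>R ?f)"
    by auto
  have "g (x + h *\<^sub>R ?e + h *\<^sub>R ?f) - g (x + h *\<^sub>R ?e) - g (x + h *\<^sub>R ?f) + g x = p h - p 0"
    by (simp add: p_def add.commute add.left_commute)
  also have "\<dots> = h\<^sup>2 * iter_partial [j, i] g (x + \<xi> *\<^sub>R ?e + \<eta> *\<^sub>R ?f)"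
    using \<xi>(3) \<eta>(3) by (simp add: power2_eq_square)
  finally show ?thesis using that inW[of \<xi> \<eta>] \<xi> \<eta> by simp
qed

text \<open>The second difference is symmetric in \<open>i\<close> and \<open>j\<close>, so a value
  of one mixed derivative near \<open>x\<close> equals a value of the other near \<open>x\<close>;
  continuity brings both to \<open>x\<close>.\<close>

lemma mixed_partials_commute:
  fixes g :: "real^'n::finite \<Rightarrow> real"
  assumes W: "open W" and g: "smooth_on_open W g" and x: "x \<in> W"
  shows "iter_partial [i, j] g x = iter_partial [j, i] g x"
proof (rule ccontr)
  assume ne: "iter_partial [i, j] g x \<noteq> iter_partial [j, i] g x"
  \<comment> \<open>Half the supposed gap, so that two errors below \<open>r\<close> cannot close
    it.\<close>
  define r where "r = \<bar>iter_partial [i, j] g x - iter_partial [j, i] g x\<bar> / 2"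
  have r: "r > 0" using ne by (simp add: r_def)
  have c: "isCont (iter_partial ds g) x" for ds
    using g x by (simp add: smooth_on_open_def differentiable_imp_continuous_within)
  obtain d1 where d1: "d1 > 0" "\<And>y. dist y x < d1 \<Longrightarrow> dist (iter_partial [i, j] g y) (iter_partial [i, j] g x) < r"
    using c[of "[i, j]"] r unfolding continuous_at_eps_delta by blast
  obtain d2 where d2: "d2 > 0" "\<And>y. dist y x < d2 \<Longrightarrow> dist (iter_partial [j, i] g y) (iter_partial [j, i] g x) < r"
    using c[of "[j, i]"] r unfolding continuous_at_eps_delta by blast
  obtain e where e: "e > 0" "cball x e \<subseteq> W" using W x open_contains_cball by blast
  define h where "h = min e (min d1 d2) / 4"
  have h: "h > 0" "2 * h < d1" "2 * h < d2" "2 * h \<le> e" using d1 d2 e by (auto simp: h_def min_def)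
  have sub: "cball x (2 * h) \<subseteq> W" using e h by (meson order_trans subset_cball)
  obtain y where y: "y \<in> cball x (2 * h)"
    "g (x + h *\<^sub>R axis i 1 + h *\<^sub>R axis j 1) - g (x + h *\<^sub>R axis i 1) - g (x + h *\<^sub>R axis j 1) + g x
      = h\<^sup>2 * iter_partial [j, i] g y"
    using mixed_difference_mean_value[OF sub g h(1)] by blast
  obtain z where z: "z \<in> cball x (2 * h)"
    "g (x + h *\<^sub>R axis j 1 + h *\<^sub>R axis i 1) - g (x + h *\<^sub>R axis j 1) - g (x + h *\<^sub>R axis i 1) + g x
      = h\<^sup>2 * iter_partial [i, j] g z"
    using mixed_difference_mean_value[OF sub g h(1)] by blast
  have eq: "x + h *\<^sub>R axis j 1 + h *\<^sub>R axis i 1 = x + h *\<^sub>R axis i 1 + h *\<^sub>R axis j 1"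
    by (simp add: algebra_simps)
  have "h\<^sup>2 * iter_partial [j, i] g y = h\<^sup>2 * iter_partial [i, j] g z" using y(2) z(2)[unfolded eq] by linarith
  then have "iter_partial [j, i] g y = iter_partial [i, j] g z" using h(1) by simp
  moreover have "dist (iter_partial [j, i] g y) (iter_partial [j, i] g x) < r"
    using y(1) h by (intro d2(2)) (simp add: dist_commute)
  moreover have "dist (iter_partial [i, j] g z) (iter_partial [i, j] g x) < r"
    using z(1) h by (intro d1(2)) (simp add: dist_commute)
  moreover have "\<bar>c - b\<bar> \<le> \<bar>a - b\<bar> + \<bar>a - c\<bar>" for a b c :: real by linarith
  ultimately show False unfolding r_def dist_real_def by (smt (verit) field_sum_of_halves)
qed

lemma hessian_symmetric:
  assumes "open W" "smooth_on_open W g" "x \<in> W"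
  shows "transpose (hessian g x) = hessian g x"
  using mixed_partials_commute[OF assms] by (simp add: hessian_def vec_eq_iff transpose_def del: iter_partial.simps)

text \<open>Second-derivative test along the line through \<open>x\<close> in direction
  \<open>v\<close>: if the form were positive, the first derivative, zero at the maximum, would be
  positive just after it and \<open>g\<close> would increase.\<close>

lemma hessian_nonpos_at_max:
  fixes g :: "real^'n::finite \<Rightarrow> real"
  assumes W: "open W" and g: "smooth_on_open W g" and x: "x \<in> W" and max: "\<And>y. y \<in> W \<Longrightarrow> g y \<le> g x"
  shows "v \<bullet> (hessian g x *v v) \<le> 0"
proof (rule ccontr)
  assume "\<not> ?thesis"
  then have pos: "v \<bullet> (hessian g x *v v) > 0" by simp
  have "v \<noteq> 0" using pos by auto
  then have nv: "norm v > 0" by simp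
  obtain e where e: "e > 0" "ball x e \<subseteq> W" using W x open_contains_ball by blast
  define r where "r = e / norm v"
  have r: "r > 0" using e nv by (simp add: r_def)
  have inW: "x + s *\<^sub>R v \<in> W" if "\<bar>s\<bar> < r" for s
  proof -
    have "norm (s *\<^sub>R v) < e" using that nv by (simp add: r_def pos_less_divide_eq)
    then have "x + s *\<^sub>R v \<in> ball x e" by (simp add: dist_norm)
    then show ?thesis using e by blast
  qed
  have diff: "iter_partial ds g differentiable (at y)" if "y \<in> W" for ds y
    using g that by (simp add: smooth_on_open_def)
  define p where "p s = g (x + s *\<^sub>R v)" for s
  define p' where "p' s = (\<Sum>j\<in>UNIV. v $ j * partial_deriv j g (x + s *\<^sub>R v))" for s
  have dp: "(p has_real_derivative p' s) (at s)" if "\<bar>s\<bar> < r" for s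
    using has_real_derivative_along[of g x s v] diff[OF inW[OF that], of "[]"]
    by (simp add: p_def[abs_def] p'_def frechet_derivative_eq_partials)
  have "(p' has_real_derivative (\<Sum>j\<in>UNIV. v $ j * (\<Sum>i\<in>UNIV. v $ i * iter_partial [i, j] g x))) (at 0)"
    unfolding p'_def[abs_def]
  proof (intro DERIV_sum DERIV_cmult)
    fix j
    have d: "partial_deriv j g differentiable (at x)" using diff[OF x, of "[j]"] by simp
    show "((\<lambda>s. partial_deriv j g (x + s *\<^sub>R v)) has_real_derivative (\<Sum>i\<in>UNIV. v $ i * iter_partial [i, j] g x)) (at 0)"
      using has_real_derivative_along[of "partial_deriv j g" x 0 v] d
      by (simp add: frechet_derivative_eq_partials)
  qed
  also have "(\<Sum>j\<in>UNIV. v $ j * (\<Sum>i\<in>UNIV. v $ i * iter_partial [i, j] g x))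
      = (\<Sum>j\<in>UNIV. \<Sum>i\<in>UNIV. v $ j * (v $ i * iter_partial [i, j] g x))"
    by (simp only: sum_distrib_left)
  also have "\<dots> = (\<Sum>i\<in>UNIV. \<Sum>j\<in>UNIV. v $ j * (v $ i * iter_partial [i, j] g x))"
    by (rule sum.swap)
  also have "\<dots> = v \<bullet> (hessian g x *v v)"
    by (simp add: inner_vec_def matrix_vector_mult_def hessian_def sum_distrib_left mult_ac del: iter_partial.simps)
  finally have d2: "(p' has_real_derivative v \<bullet> (hessian g x *v v)) (at 0)" .
  have "p' 0 = 0"
  proof (rule DERIV_local_max[OF dp r])
    show "\<bar>0\<bar> < r" using r by simp
    show "\<forall>s. \<bar>0 - s\<bar> < r \<longrightarrow> p s \<le> p 0" using max inW by (simp add: p_def)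
  qed
  then obtain d where d: "d > 0" "\<And>s. 0 < s \<Longrightarrow> s < d \<Longrightarrow> p' s > 0"
    using DERIV_pos_inc_right[OF d2 pos] by auto
  define s where "s = min d r / 2"
  have s: "0 < s" "s < d" "s < r" using d r by (auto simp: s_def min_def)
  have "p 0 < p s"
  proof (rule DERIV_pos_imp_increasing_open[OF s(1)])
    show "\<exists>y. (p has_real_derivative y) (at t) \<and> y > 0" if "0 < t" "t < s" for t
      using dp[of t] d(2)[of t] that s by auto
    show "continuous_on {0..s} p"
    proof (intro continuous_at_imp_continuous_on ballI)
      fix t assume "t \<in> {0..s}"
      then have "\<bar>t\<bar> < r" using s by auto
      from DERIV_isCont[OF dp[OF this]] show "isCont p t" .
    qed
  qed
  moreover have "p s \<le> p 0" using max[OF inW[of s]] s by (simp add: p_def)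
  ultimately show False by simp
qed

text \<open>Ellipticity enters only through \<open>int\<close>, so the same principle serves the
  linear equation for \<open>w\<close> and the nonlinear one for \<open>u\<close>. A maximum over
  the compact closure is excluded from \<open>\<Omega>\<close> and hence lies on the
  frontier.\<close>

lemma hessian_maximum_principle:
  fixes g :: "real^'n::finite \<Rightarrow> real"
  assumes \<Omega>: "open \<Omega>" "bounded \<Omega>" and g: "smooth_up_to_boundary \<Omega> g" and bd: "\<And>x. x \<in> frontier \<Omega> \<Longrightarrow> g x \<le> 0"
    and int: "\<And>x. x \<in> \<Omega> \<Longrightarrow> (\<And>v. v \<bullet> (hessian g x *v v) \<le> 0) \<Longrightarrow> False"
    and x: "x \<in> \<Omega>"
  shows "g x \<le> 0"
proof -
  have "compact (closure \<Omega>)" using \<Omega>(2) by simp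
  moreover have "closure \<Omega> \<noteq> {}" using x closure_subset by blast
  moreover have "continuous_on (closure \<Omega>) g" using g by (simp add: smooth_up_to_boundary_def)
  ultimately obtain y where y: "y \<in> closure \<Omega>" "\<And>z. z \<in> closure \<Omega> \<Longrightarrow> g z \<le> g y"
    using continuous_attains_sup by metis
  have "y \<notin> \<Omega>"
  proof
    assume "y \<in> \<Omega>"
    moreover have "smooth_on_open \<Omega> g" using g by (simp add: smooth_up_to_boundary_def)
    ultimately have "v \<bullet> (hessian g y *v v) \<le> 0" for v
      using hessian_nonpos_at_max[OF \<Omega>(1)] y(2) closure_subset by blast
    then show False using int[OF \<open>y \<in> \<Omega>\<close>] by blast
  qed
  then have "y \<in> frontier \<Omega>" using y(1) \<Omega>(1) by (simp add: frontier_def interior_open)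
  then show ?thesis using bd y(2)[of x] x closure_subset by fastforce
qed

text \<open>Each derivative extends continuously to the compact closure; one constant collects the
  bounds on \<open>g\<close> and its second derivatives.\<close>

lemma smooth_up_to_boundary_hessian_bounded:
  fixes g :: "real^'n::finite \<Rightarrow> real"
  assumes "bounded \<Omega>" and g: "smooth_up_to_boundary \<Omega> g"
  obtains K where "K \<ge> 0" "\<And>x i j. x \<in> \<Omega> \<Longrightarrow> \<bar>hessian g x $ i $ j\<bar> \<le> K"
    "\<And>x. x \<in> \<Omega> \<Longrightarrow> \<bar>g x\<bar> \<le> K"
proof -
  have "\<exists>K. \<forall>x\<in>\<Omega>. \<bar>iter_partial ds g x\<bar> \<le> K" for ds
  proof -
    obtain h where h: "continuous_on (closure \<Omega>) h" "\<And>x. x \<in> \<Omega> \<Longrightarrow> h x = iter_partial ds g x"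
      using g unfolding smooth_up_to_boundary_def by blast
    have "bounded (h ` closure \<Omega>)"
      using assms(1) h(1) by (intro compact_imp_bounded compact_continuous_image) auto
    then obtain K where "\<And>y. y \<in> h ` closure \<Omega> \<Longrightarrow> norm y \<le> K" unfolding bounded_iff by blast
    then show ?thesis using h(2) closure_subset by (metis image_eqI real_norm_def subsetD)
  qed
  then obtain K where K: "\<And>ds x. x \<in> \<Omega> \<Longrightarrow> \<bar>iter_partial ds g x\<bar> \<le> K ds" by metis
  define L where "L = \<bar>K []\<bar> + (\<Sum>i\<in>UNIV. \<Sum>j\<in>UNIV. \<bar>K [i, j]\<bar>)"
  show ?thesis
  proof
    show "L \<ge> 0" by (simp add: L_def sum_nonneg)
    fix x assume x: "x \<in> \<Omega>"
    show "\<bar>g x\<bar> \<le> L" using K[OF x, of "[]"] by (auto simp: L_def intro!: add_increasing2 sum_nonneg)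
    fix i j
    have "\<bar>K [i, j]\<bar> \<le> (\<Sum>j\<in>UNIV. \<bar>K [i, j]\<bar>)" by (intro member_le_sum) auto
    also have "\<dots> \<le> (\<Sum>i\<in>UNIV. \<Sum>j\<in>UNIV. \<bar>K [i, j]\<bar>)"
      by (intro member_le_sum[where f = "\<lambda>i. \<Sum>j\<in>UNIV. \<bar>K [i, j]\<bar>"]) (auto intro: sum_nonneg)
    finally show "\<bar>hessian g x $ i $ j\<bar> \<le> L"
      using K[OF x, of "[i, j]"] by (simp add: hessian_def L_def del: iter_partial.simps)
  qed
qed

section \<open>Perturbations of orthogonal projections\<close>

lemma orth_proj_unique:
  assumes "subspace E" "p \<in> E" "x - p \<in> E\<^sup>\<bottom>"
  shows "orth_proj E x = p"
  unfolding orth_proj_def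
proof (rule the_equality)
  fix q assume q: "q \<in> E \<and> x - q \<in> E\<^sup>\<bottom>"
  have "(x - p) - (x - q) \<in> E\<^sup>\<bottom>" using q assms(3) subspace_orthogonal_comp subspace_diff by blast
  then have "q - p \<in> E\<^sup>\<bottom>" by simp
  moreover have "q - p \<in> E" using q assms subspace_diff by blast
  ultimately have "q - p \<in> E \<inter> E\<^sup>\<bottom>" by (rule IntI[rotated])
  then show "q = p" unfolding orthogonal_Int_0[OF assms(1)] by simp
qed (use assms in simp)

lemma orth_proj_props:
  assumes "subspace E"
  shows "orth_proj E x \<in> E" and "x - orth_proj E x \<in> E\<^sup>\<bottom>"
proof -
  obtain p q where "x = p + q" "p \<in> E" "q \<in> E\<^sup>\<bottom>"
    using subspace_sum_orthogonal_comp[OF assms] by (metis UNIV_I set_plus_elim)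
  then have "p \<in> E" "x - p \<in> E\<^sup>\<bottom>" by auto
  then show "orth_proj E x \<in> E" "x - orth_proj E x \<in> E\<^sup>\<bottom>"
    using orth_proj_unique[OF assms] by metis+
qed

lemma orth_proj_eq_self: "subspace E \<Longrightarrow> orth_proj E x = x \<longleftrightarrow> x \<in> E"
  by (metis diff_self orth_proj_props(1) orth_proj_unique subspace_0 subspace_orthogonal_comp)

lemma linear_orth_proj:
  fixes E :: "(real^'n::finite) set"
  assumes E: "subspace E"
  shows "linear (orth_proj E)"
proof (rule linearI)
  fix x y :: "real^'n" and c :: real
  have "(x - orth_proj E x) + (y - orth_proj E y) \<in> E\<^sup>\<bottom>"
    by (intro subspace_add subspace_orthogonal_comp orth_proj_props E)
  then show "orth_proj E (x + y) = orth_proj E x + orth_proj E y"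
    by (intro orth_proj_unique E subspace_add orth_proj_props) (simp add: algebra_simps)
  have "c *\<^sub>R (x - orth_proj E x) \<in> E\<^sup>\<bottom>"
    by (intro subspace_scale subspace_orthogonal_comp orth_proj_props E)
  then show "orth_proj E (c *\<^sub>R x) = c *\<^sub>R orth_proj E x"
    by (intro orth_proj_unique E subspace_scale orth_proj_props) (simp add: algebra_simps)
qed

lemma orth_proj_inner:
  assumes "subspace E"
  shows "orth_proj E x \<bullet> y = orth_proj E x \<bullet> orth_proj E y"
  using orth_proj_props(1)[OF assms, of x] orth_proj_props(2)[OF assms, of y]
  by (simp add: orthogonal_comp_def orthogonal_def inner_diff_right)

lemma orth_proj_complement:
  assumes "subspace E"
  shows "orth_proj (E\<^sup>\<bottom>) x = x - orth_proj E x"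
  using orth_proj_props[OF assms, of x]
  by (intro orth_proj_unique subspace_orthogonal_comp) (simp_all add: orthogonal_comp_self[OF assms])

definition orth_proj_matrix :: "(real^'n::finite) set \<Rightarrow> real^'n^'n" where
  "orth_proj_matrix E = matrix (orth_proj E)"

lemma orth_proj_matrix_works: "subspace E \<Longrightarrow> orth_proj_matrix E *v x = orth_proj E x"
  by (simp add: orth_proj_matrix_def linear_orth_proj matrix_works)

lemma orth_proj_matrix_symmetric:
  assumes "subspace E"
  shows "transpose (orth_proj_matrix E) = orth_proj_matrix E"
proof -
  have "orth_proj_matrix E $ i $ j = axis i 1 \<bullet> orth_proj E (axis j 1)" for i j
    by (simp add: orth_proj_matrix_def matrix_def inner_axis')
  moreover have "axis i 1 \<bullet> orth_proj E (axis j 1) = axis j 1 \<bullet> orth_proj E (axis i 1)" for i j :: 'a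
    using orth_proj_inner[OF assms, of "axis i 1" "axis j 1"] orth_proj_inner[OF assms, of "axis j 1" "axis i 1"]
    by (simp add: inner_commute)
  ultimately show ?thesis by (simp add: vec_eq_iff transpose_def)
qed

lemma orth_proj_matrix_complement:
  assumes "subspace E"
  shows "orth_proj_matrix (E\<^sup>\<bottom>) = mat 1 - orth_proj_matrix E"
proof -
  have "orth_proj_matrix (E\<^sup>\<bottom>) *v x = (mat 1 - orth_proj_matrix E) *v x" for x
    using assms by (simp add: orth_proj_matrix_works subspace_orthogonal_comp orth_proj_complement matrix_vector_mult_diff_rdistrib)
  then show ?thesis by (simp add: matrix_eq)
qed

section \<open>Spectral form of a projection and expansion of \<open>\<sigma>\<^sub>k\<close> around
  it\<close>

definition indvec :: "'n set \<Rightarrow> real^'n::finite" where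
  "indvec T = (\<chi> i. if i \<in> T then 1 else 0)"

lemma diag_mult_vec: "diag d *v v = (\<chi> i. d $ i * v $ i)"
  by (simp add: vec_eq_iff diag_def matrix_vector_mult_def if_distrib[where f="\<lambda>y. y * _"] cong: if_cong)

lemma diag_mult_entry: "(diag d ** A) $ i $ j = d $ i * A $ i $ j"
  by (simp add: diag_def matrix_matrix_mult_def if_distrib[where f="\<lambda>y. y * _"] cong: if_cong)

text \<open>Idempotence forces the eigenvalues 0 and 1. The rank is read off from \<open>E\<close>
  being the image under \<open>Q\<close> of the coordinate subspace belonging to
  \<open>T\<close>.\<close>

lemma orth_proj_diagonal:
  fixes E :: "(real^'n::finite) set"
  assumes E: "subspace E"
  obtains Q T where "orthogonal_matrix Q" "card T = dim E"
    "orth_proj_matrix E = Q ** diag (indvec T) ** transpose Q"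
proof -
  let ?P = "orth_proj_matrix E"
  obtain Q d where Q: "orthogonal_matrix Q" and P: "?P = Q ** diag d ** transpose Q"
    using symmetric_diagonalizable[OF orth_proj_matrix_symmetric[OF E]] by blast
  have QQ: "Q ** transpose Q = mat 1" "transpose Q ** Q = mat 1"
    using Q by (simp_all add: orthogonal_matrix_def)
  have QQv: "Q *v (transpose Q *v x) = x" "transpose Q *v (Q *v x) = x" for x
    unfolding matrix_vector_mul_assoc QQ by simp_all
  have Pv: "orth_proj E x = Q *v (diag d *v (transpose Q *v x))" for x
    using orth_proj_matrix_works[OF E, of x] by (simp add: P matrix_vector_mul_assoc matrix_mul_assoc del: transpose_matrix_vector)
  define T where "T = {i. d $ i \<noteq> 0}"
  have d01: "d $ i = 1" if "i \<in> T" for i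
  proof -
    let ?x = "Q *v axis i 1"
    have P1: "orth_proj E ?x = Q *v (diag d *v axis i 1)" unfolding Pv QQv ..
    have "orth_proj E (orth_proj E ?x) = orth_proj E ?x"
      using orth_proj_props(1)[OF E] orth_proj_eq_self[OF E] by blast
    then have "Q *v (diag d *v (diag d *v axis i 1)) = Q *v (diag d *v axis i 1)"
      unfolding P1 Pv QQv .
    then have "diag d *v (diag d *v axis i 1) = diag d *v axis i 1" by (metis QQv(2))
    then have "d $ i * (d $ i * 1) = d $ i * 1"
      unfolding diag_mult_vec by (auto simp: vec_eq_iff axis_def dest: spec[of _ i])
    then show ?thesis using that by (simp add: T_def)
  qed
  have dT: "d = indvec T"
    using d01 by (auto simp: vec_eq_iff indvec_def T_def)
  define S where "S = {v :: real^'n. \<forall>i. i \<notin> T \<longrightarrow> v $ i = 0}"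
  have fixS: "diag d *v v = v \<longleftrightarrow> v \<in> S" for v
    by (auto simp: diag_mult_vec vec_eq_iff dT indvec_def S_def)
  have "E = (*v) Q ` S"
  proof (intro set_eqI iffI)
    fix x assume "x \<in> E"
    then have "Q *v (diag d *v (transpose Q *v x)) = x" using orth_proj_eq_self[OF E, of x] Pv by simp
    then have "diag d *v (transpose Q *v x) = transpose Q *v x" by (metis QQv(2))
    then show "x \<in> (*v) Q ` S" using fixS QQv(1) by (metis image_eqI)
  next
    fix x assume "x \<in> (*v) Q ` S"
    then obtain v where v: "x = Q *v v" "diag d *v v = v" using fixS by blast
    then have "orth_proj E x = x" by (simp only: Pv v QQv)
    then show "x \<in> E" using orth_proj_eq_self[OF E] by blast
  qed
  moreover have "inj_on ((*v) Q) (span S)" by (intro inj_onI) (metis QQv(2))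
  ultimately have "dim E = dim S"
    using dim_image_eq[OF matrix_vector_mul_linear[of Q]] by blast
  also have "\<dots> = card T" unfolding S_def using dim_substandard_cart[of T, where 'a = real] by (simp only: dim_vec_eq)
  finally show ?thesis using that[OF Q] P dT by simp
qed

text \<open>Writes the Laplacian along the orthogonal complement in the same eigenbasis as the
  expansion of \<open>msym\<close>, by cyclicity of the trace.\<close>

lemma trace_orth_proj_complement:
  fixes Q M :: "real^'n^'n::finite"
  assumes E: "subspace E" and Q: "orthogonal_matrix Q"
    and P: "orth_proj_matrix E = Q ** diag (indvec T) ** transpose Q"
  shows "trace (orth_proj_matrix (E\<^sup>\<bottom>) ** M) = (\<Sum>i\<in>-T. (transpose Q ** M ** Q) $ i $ i)"
proof -
  have QQ: "Q ** transpose Q = mat 1" using Q by (simp add: orthogonal_matrix_def)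
  have d: "diag (indvec (-T)) = mat 1 + (-1) *\<^sub>R diag (indvec T)"
    by (auto simp: vec_eq_iff diag_def indvec_def mat_def)
  have "Q ** ((-1) *\<^sub>R diag (indvec T)) ** transpose Q = (-1) *\<^sub>R orth_proj_matrix E"
    unfolding P by (simp only: matrix_scalar_ac scalar_matrix_assoc)
  then have "orth_proj_matrix (E\<^sup>\<bottom>) = Q ** diag (indvec (-T)) ** transpose Q"
    unfolding orth_proj_matrix_complement[OF E] d matrix_add_ldistrib matrix_add_mult_distrib
    by (simp add: QQ)
  then have "trace (orth_proj_matrix (E\<^sup>\<bottom>) ** M) = trace (Q ** (diag (indvec (-T)) ** transpose Q ** M))"
    by (simp only: matrix_mul_assoc)
  also have "\<dots> = trace (diag (indvec (-T)) ** (transpose Q ** M ** Q))"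
    by (subst trace_mul_sym) (simp only: matrix_mul_assoc)
  also have "\<dots> = (\<Sum>i\<in>UNIV. if i \<in> -T then (transpose Q ** M ** Q) $ i $ i else 0)"
    unfolding trace_def
    by (intro sum.cong refl) (simp add: diag_mult_entry indvec_def)
  also have "\<dots> = (\<Sum>i\<in>-T. (transpose Q ** M ** Q) $ i $ i)"
    by (simp flip: sum.inter_filter add: Collect_neg_eq)
  finally show ?thesis .
qed

lemma prod_indvec: "(\<Prod>i\<in>S. indvec T $ i) = (if S \<subseteq> T then 1 else 0)"
  by (auto simp: indvec_def intro!: prod.neutral)

lemma elem_sym_indvec: "elem_sym j (indvec T) = real (card T choose j)"
proof -
  have "elem_sym j (indvec T) = (\<Sum>S\<in>{S. S \<subseteq> UNIV \<and> card S = j}. if S \<subseteq> T then 1 else 0)"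
    by (simp add: elem_sym_def prod_indvec)
  also have "\<dots> = real (card {S. S \<subseteq> T \<and> card S = j})"
    by (simp flip: sum.inter_filter add: conj_commute)
  finally show ?thesis by (simp add: n_subsets)
qed

text \<open>The only subset of \<open>T\<close> of size \<open>m\<close> is \<open>T\<close>, and it
  counts only if it avoids \<open>i\<close>. So at a projection of rank \<open>m\<close> the
  first-order term of \<open>\<sigma>\<^sub>m\<^sub>+\<^sub>1\<close> sees the kernel directions
  alone.\<close>

lemma esym_delete_indvec:
  assumes "card T = m"
  shows "esym (UNIV - {i}) m (($) (indvec T)) = (if i \<in> T then 0 else 1)"
proof -
  have "esym (UNIV - {i}) m (($) (indvec T)) = (\<Sum>S\<in>{S. S \<subseteq> UNIV - {i} \<and> card S = m}. if S = T then 1 else 0)"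
    unfolding esym_def prod_indvec
    using assms by (intro sum.cong) (auto dest: card_subset_eq[OF finite])
  then show ?thesis using assms by auto
qed

lemma orthogonal_conj_entry_bound:
  fixes Q M :: "real^'n^'n::finite"
  assumes Q: "orthogonal_matrix Q" and M: "\<And>i j. \<bar>M $ i $ j\<bar> \<le> K"
  shows "\<bar>(transpose Q ** M ** Q) $ i $ j\<bar> \<le> real CARD('n) * (real CARD('n) * K)"
proof -
  have Q1: "\<bar>Q $ i $ j\<bar> \<le> 1" for i j
  proof -
    have "norm (column j Q) = 1" using Q by (simp add: orthogonal_matrix_orthonormal_columns)
    then show ?thesis using component_le_norm_cart[of "column j Q" i] by (simp add: column_def)
  qed
  have K: "K \<ge> 0" using M[of i j] by linarith
  have "\<bar>(\<Sum>l\<in>UNIV. \<Sum>m\<in>UNIV. Q $ m $ i * M $ m $ l * Q $ l $ j)\<bar> \<le> (\<Sum>l\<in>(UNIV::'n set). \<Sum>m\<in>(UNIV::'n set). K)"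
  proof (intro order_trans[OF sum_abs] sum_mono)
    fix l m
    have "\<bar>Q $ m $ i\<bar> * \<bar>M $ m $ l\<bar> * \<bar>Q $ l $ j\<bar> \<le> 1 * K * 1"
      using K by (intro mult_mono Q1 M) auto
    then show "\<bar>Q $ m $ i * M $ m $ l * Q $ l $ j\<bar> \<le> K" by (simp add: abs_mult)
  qed
  moreover have "(transpose Q ** M ** Q) $ i $ j = (\<Sum>l\<in>UNIV. \<Sum>m\<in>UNIV. Q $ m $ i * M $ m $ l * Q $ l $ j)"
    by (simp add: matrix_matrix_mult_def transpose_def sum_distrib_right)
  ultimately show ?thesis by simp
qed

text \<open>The term of order zero vanishes because the rank is \<open>k - 1\<close>; the
  first-order coefficients pick the diagonal entries of the conjugated \<open>M\<close> outside
  \<open>T\<close>, which add up to the trace. Thus the Poisson equation along the complement is the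
  linearization of \<open>\<sigma>\<^sub>k\<close> here.\<close>

lemma msym_near_projection:
  fixes E :: "(real^'n::finite) set"
  assumes E: "subspace E" and k: "k \<ge> 1" and dim: "dim E = k - 1" and K: "K \<ge> 0"
  obtains C where "C \<ge> 0" "\<And>\<epsilon> M. \<bar>\<epsilon>\<bar> \<le> 1 \<Longrightarrow> (\<And>i j. \<bar>M $ i $ j\<bar> \<le> K) \<Longrightarrow>
     \<bar>msym k (orth_proj_matrix E + \<epsilon> *\<^sub>R M) - \<epsilon> * trace (orth_proj_matrix (E\<^sup>\<bottom>) ** M)\<bar> \<le> C * \<epsilon>\<^sup>2"
proof -
  obtain Q T where Q: "orthogonal_matrix Q" and T: "card T = k - 1"
    and P: "orth_proj_matrix E = Q ** diag (indvec T) ** transpose Q"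
    using orth_proj_diagonal[OF E] dim by metis
  \<comment> \<open>\<open>L\<close> bounds both the entries 0 and 1 of \<open>indvec T\<close> and
    the entries of \<open>M\<close> after conjugation.\<close>
  define L where "L = max 1 (real CARD('n) * (real CARD('n) * K))"
  have L0: "L \<ge> 0" by (simp add: L_def)
  obtain C where C: "C \<ge> 0" "\<And>\<epsilon> (d :: real^'n) M. \<bar>\<epsilon>\<bar> \<le> 1 \<Longrightarrow> (\<And>i. \<bar>d $ i\<bar> \<le> L) \<Longrightarrow> (\<And>i j. \<bar>M $ i $ j\<bar> \<le> L) \<Longrightarrow>
     \<bar>msym k (diag d + \<epsilon> *\<^sub>R M) - elem_sym k d - \<epsilon> * (\<Sum>i\<in>UNIV. M $ i $ i * esym (UNIV - {i}) (k - 1) (($) d))\<bar> \<le> C * \<epsilon>\<^sup>2"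
    using msym_perturbation[OF L0 k] by blast
  show ?thesis
  proof (rule that[OF C(1)])
    fix \<epsilon> :: real and M :: "real^'n^'n" assume e: "\<bar>\<epsilon>\<bar> \<le> 1" and M: "\<And>i j. \<bar>M $ i $ j\<bar> \<le> K"
    define N where "N = transpose Q ** M ** Q"
    have N: "\<bar>N $ i $ j\<bar> \<le> L" for i j
      unfolding N_def L_def using orthogonal_conj_entry_bound[OF Q M] by (simp add: max.coboundedI2)
    have "\<bar>indvec T $ i\<bar> \<le> L" for i using L0 by (simp add: indvec_def) (simp add: L_def)
    note est = C(2)[OF e this N]
    have "msym k (orth_proj_matrix E + \<epsilon> *\<^sub>R M) = msym k (diag (indvec T) + \<epsilon> *\<^sub>R N)"
      unfolding N_def using orthogonal_conj_add[OF Q P] msym_similar[OF Q] by metis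
    moreover have "elem_sym k (indvec T) = 0"
      using T k by (simp add: elem_sym_indvec binomial_eq_0)
    moreover have "(\<Sum>i\<in>UNIV. N $ i $ i * esym (UNIV - {i}) (k - 1) (($) (indvec T)))
        = (\<Sum>i\<in>UNIV. if i \<in> -T then N $ i $ i else 0)"
      by (intro sum.cong) (simp_all add: esym_delete_indvec[OF T] del: One_nat_def)
    moreover have "\<dots> = trace (orth_proj_matrix (E\<^sup>\<bottom>) ** M)"
      unfolding trace_orth_proj_complement[OF E Q P] N_def[symmetric]
      by (simp flip: sum.inter_filter add: Collect_neg_eq)
    ultimately show "\<bar>msym k (orth_proj_matrix E + \<epsilon> *\<^sub>R M) - \<epsilon> * trace (orth_proj_matrix (E\<^sup>\<bottom>) ** M)\<bar> \<le> C * \<epsilon>\<^sup>2"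
      using est by simp
  qed
qed

text \<open>At the projection itself the value is a binomial coefficient, hence at least 1, and the
  perturbation changes it by at most \<open>\<bar>\<epsilon>\<bar> * (B + C)\<close>.\<close>

lemma msym_pos_near_projection:
  fixes E :: "(real^'n::finite) set"
  assumes E: "subspace E" and j: "1 \<le> j" "j \<le> dim E" and K: "K \<ge> 0"
  shows "\<exists>\<epsilon>\<^sub>0>0. \<forall>\<epsilon> M. \<bar>\<epsilon>\<bar> \<le> \<epsilon>\<^sub>0 \<longrightarrow> (\<forall>i j. \<bar>M $ i $ j\<bar> \<le> K) \<longrightarrow> msym j (orth_proj_matrix E + \<epsilon> *\<^sub>R M) > 0"
proof -
  obtain Q T where Q: "orthogonal_matrix Q" and T: "card T = dim E"
    and P: "orth_proj_matrix E = Q ** diag (indvec T) ** transpose Q"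
    using orth_proj_diagonal[OF E] by metis
  define L where "L = max 1 (real CARD('n) * (real CARD('n) * K))"
  have L0: "L \<ge> 0" by (simp add: L_def)
  obtain C where C: "C \<ge> 0" "\<And>\<epsilon> (d :: real^'n) M. \<bar>\<epsilon>\<bar> \<le> 1 \<Longrightarrow> (\<And>i. \<bar>d $ i\<bar> \<le> L) \<Longrightarrow> (\<And>i j. \<bar>M $ i $ j\<bar> \<le> L) \<Longrightarrow>
     \<bar>msym j (diag d + \<epsilon> *\<^sub>R M) - elem_sym j d - \<epsilon> * (\<Sum>i\<in>UNIV. M $ i $ i * esym (UNIV - {i}) (j - 1) (($) d))\<bar> \<le> C * \<epsilon>\<^sup>2"
    using msym_perturbation[OF L0 j(1)] by blast
  define B where "B = (\<Sum>i\<in>UNIV. L * \<bar>esym (UNIV - {i}) (j - 1) (($) (indvec T))\<bar>)"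
  from L0 have B: "B \<ge> 0" by (simp add: B_def sum_nonneg)
  \<comment> \<open>The denominator gives both \<open>\<epsilon>\<^sub>0 \<le> 1\<close>, where the
    expansion is valid, and \<open>\<epsilon>\<^sub>0 * (B + C) < 1\<close>.\<close>
  define \<epsilon>\<^sub>0 where "\<epsilon>\<^sub>0 = 1 / (B + C + 2)"
  have e0: "\<epsilon>\<^sub>0 > 0" "\<epsilon>\<^sub>0 \<le> 1" using B C(1) by (simp_all add: \<epsilon>\<^sub>0_def)
  have "msym j (orth_proj_matrix E + \<epsilon> *\<^sub>R M) > 0" if e: "\<bar>\<epsilon>\<bar> \<le> \<epsilon>\<^sub>0" and M: "\<forall>i j. \<bar>M $ i $ j\<bar> \<le> K" for \<epsilon> M
  proof -
    define N where "N = transpose Q ** M ** Q"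
    have N: "\<bar>N $ i $ j\<bar> \<le> L" for i j
      unfolding N_def L_def using orthogonal_conj_entry_bound[OF Q, of M K] M by (simp add: max.coboundedI2)
    have "\<bar>indvec T $ i\<bar> \<le> L" for i using L0 by (simp add: indvec_def) (simp add: L_def)
    moreover have e1: "\<bar>\<epsilon>\<bar> \<le> 1" using e e0 by linarith
    ultimately have est: "\<bar>msym j (diag (indvec T) + \<epsilon> *\<^sub>R N) - elem_sym j (indvec T)
       - \<epsilon> * (\<Sum>i\<in>UNIV. N $ i $ i * esym (UNIV - {i}) (j - 1) (($) (indvec T)))\<bar> \<le> C * \<epsilon>\<^sup>2"
      using C(2) N by blast
    have "\<bar>(\<Sum>i\<in>UNIV. N $ i $ i * esym (UNIV - {i}) (j - 1) (($) (indvec T)))\<bar> \<le> B"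
      unfolding B_def by (intro order_trans[OF sum_abs] sum_mono) (simp add: abs_mult N mult_right_mono)
    then have 1: "\<bar>\<epsilon> * (\<Sum>i\<in>UNIV. N $ i $ i * esym (UNIV - {i}) (j - 1) (($) (indvec T)))\<bar> \<le> \<bar>\<epsilon>\<bar> * B"
      by (simp add: abs_mult mult_left_mono)
    have "\<epsilon>\<^sup>2 \<le> \<bar>\<epsilon>\<bar>" using mult_left_mono[OF e1, of "\<bar>\<epsilon>\<bar>"] by (simp add: power2_eq_square)
    then have 2: "C * \<epsilon>\<^sup>2 \<le> \<bar>\<epsilon>\<bar> * C" using C(1) by (metis mult.commute mult_left_mono)
    have "\<bar>\<epsilon>\<bar> * (B + C) \<le> \<epsilon>\<^sub>0 * (B + C)" using e B C(1) by (simp add: mult_right_mono)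
    also have "\<dots> < 1" using B C(1) by (simp add: \<epsilon>\<^sub>0_def)
    finally have 3: "\<bar>\<epsilon>\<bar> * B + \<bar>\<epsilon>\<bar> * C < 1" by (simp add: distrib_left)
    have "card T choose j > 0" using j T by (simp add: zero_less_binomial_iff)
    then have "elem_sym j (indvec T) \<ge> 1" by (simp add: elem_sym_indvec Suc_le_eq)
    then have "msym j (diag (indvec T) + \<epsilon> *\<^sub>R N) > 0" using est 1 2 3 by linarith
    moreover have "msym j (orth_proj_matrix E + \<epsilon> *\<^sub>R M) = msym j (diag (indvec T) + \<epsilon> *\<^sub>R N)"
      unfolding N_def using orthogonal_conj_add[OF Q P] msym_similar[OF Q] by metis
    ultimately show ?thesis by simp
  qed
  then show ?thesis using e0 by blast
qed

text \<open>In an eigenbasis of the projection the trace is a sum of values of the quadratic form of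
  \<open>H\<close> on columns of \<open>Q\<close>.\<close>

lemma trace_orth_proj_nonpos:
  fixes E :: "(real^'n::finite) set"
  assumes E: "subspace E" and H: "\<And>v. v \<bullet> (H *v v) \<le> 0"
  shows "trace (orth_proj_matrix (E\<^sup>\<bottom>) ** H) \<le> 0"
proof -
  obtain Q T where Q: "orthogonal_matrix Q" and P: "orth_proj_matrix E = Q ** diag (indvec T) ** transpose Q"
    using orth_proj_diagonal[OF E] by metis
  show ?thesis
    unfolding trace_orth_proj_complement[OF E Q P] conj_diag_entry by (intro sum_nonpos H)
qed

section \<open>The boundary datum \<open>\<phi> E\<close>\<close>

lemma \<phi>_quadratic:
  assumes E: "subspace E"
  shows "\<phi> E = (\<lambda>x. x \<bullet> (((1/2) *\<^sub>R orth_proj_matrix E) *v x) + 0 \<bullet> x + 0)"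
proof
  fix x
  have "(norm (orth_proj E x))\<^sup>2 = x \<bullet> orth_proj E x"
    using orth_proj_inner[OF E, of x x] by (simp add: power2_norm_eq_inner inner_commute)
  then show "\<phi> E x = x \<bullet> (((1/2) *\<^sub>R orth_proj_matrix E) *v x) + 0 \<bullet> x + 0"
    by (simp add: \<phi>_def orth_proj_matrix_works[OF E] flip: scaleR_matrix_vector_assoc)
qed

lemma \<phi>_smooth: "subspace E \<Longrightarrow> smooth_up_to_boundary \<Omega> (\<phi> E)"
  unfolding \<phi>_quadratic quadratic_function_def[symmetric]
  by (intro quadratic_smooth_up_to_boundary) (unfold quadratic_function_def, blast)

lemma hessian_\<phi>:
  fixes E :: "(real^'n::finite) set"
  assumes E: "subspace E"
  shows "hessian (\<phi> E) x = orth_proj_matrix E"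
proof -
  let ?P = "orth_proj_matrix E"
  let ?B = "(1/2) *\<^sub>R ?P"
  have "transpose ?B *v axis j 1 + ?B *v axis j 1 = ?P *v axis j 1" for j
    by (simp add: transpose_scalar orth_proj_matrix_symmetric[OF E] flip: scaleR_matrix_vector_assoc scaleR_add_left
        del: transpose_matrix_vector)
  then have 1: "partial_deriv j (\<phi> E) = (\<lambda>x. x \<bullet> (0 *v x) + (?P *v axis j 1) \<bullet> x + 0)" for j
    unfolding \<phi>_quadratic[OF E] partial_deriv_quadratic by (simp del: transpose_matrix_vector)
  have "partial_deriv i (partial_deriv j (\<phi> E)) x = (?P *v axis j 1) \<bullet> axis i 1" for i j
  proof -
    have "transpose 0 = (0 :: real^'n^'n)" by (simp add: vec_eq_iff transpose_def)
    then show ?thesis unfolding 1 partial_deriv_quadratic by (simp del: transpose_matrix_vector)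
  qed
  then show ?thesis
    by (simp add: hessian_def vec_eq_iff inner_axis matrix_vector_mul_component inner_axis)
qed

section \<open>Comparison and barriers\<close>

lemma trace_lincomb:
  "trace (A ** (a *\<^sub>R X + b *\<^sub>R Y)) = a * trace (A ** X) + b * trace (A ** Y)"
  for A X Y :: "real^'n^'n::finite"
  by (simp add: trace_def matrix_matrix_mult_def sum.distrib sum_distrib_left distrib_left mult_ac)

text \<open>Each point of \<open>\<Omega>\<close> lies on the section over its own projection, so
  the fiberwise equations together hold throughout \<open>\<Omega>\<close>.\<close>

lemma fiberwise_poisson_laplacian:
  assumes E: "subspace E" and w: "fiberwise_poisson_correction \<Omega> E f w" and x: "x \<in> \<Omega>"
  shows "trace (orth_proj_matrix (E\<^sup>\<bottom>) ** hessian w x) = f x"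
proof -
  have "x = orth_proj E x + (x - orth_proj E x)" by simp
  then have "x \<in> (+) (orth_proj E x) ` (E\<^sup>\<bottom>)" using orth_proj_props(2)[OF E] by blast
  then show ?thesis
    using w x unfolding fiberwise_poisson_correction_def Let_def laplacian_along_def orth_proj_matrix_def by blast
qed

text \<open>Ensures that the constants of the error bound, obtained for one correction, serve all of them.
  The strict inequality needed for the maximum principle comes from adding \<open>e * v\<close> to \<open>w - v\<close>.\<close>

lemma fiberwise_poisson_le:
  fixes \<Omega> E :: "(real^'n::finite) set"
  assumes \<Omega>: "open \<Omega>" "bounded \<Omega>" and E: "subspace E" and f: "\<And>x. x \<in> \<Omega> \<Longrightarrow> f x > 0"
    and w: "fiberwise_poisson_correction \<Omega> E f w" and v: "fiberwise_poisson_correction \<Omega> E f v"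
    and x: "x \<in> \<Omega>"
  shows "w x \<le> v x"
proof (rule ccontr)
  assume "\<not> w x \<le> v x"
  then have c: "w x - v x > 0" by simp
  have sw: "smooth_up_to_boundary \<Omega> w" and sv: "smooth_up_to_boundary \<Omega> v"
    using w v by (auto simp: fiberwise_poisson_correction_def)
  have bd: "w x = 0" "v x = 0" if "x \<in> frontier \<Omega>" for x
    using w v that by (auto simp: fiberwise_poisson_correction_def)
  \<comment> \<open>The choice makes \<open>e * \<bar>v x\<bar>\<close> at most half the supposed
    gap; the 1 covers \<open>v x = 0\<close>.\<close>
  define e where "e = (w x - v x) / (2 * (\<bar>v x\<bar> + 1))"
  have e: "e > 0" using c by (simp add: e_def)
  let ?g = "\<lambda>x. 1 * w x + (e - 1) * v x"
  have "?g x \<le> 0"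
  proof (rule hessian_maximum_principle[OF \<Omega> _ _ _ x])
    show "smooth_up_to_boundary \<Omega> ?g" by (rule smooth_up_to_boundary_lincomb[OF \<Omega>(1) sw sv])
    show "?g z \<le> 0" if "z \<in> frontier \<Omega>" for z using bd that by simp
    fix z assume z: "z \<in> \<Omega>" and H: "\<And>a. a \<bullet> (hessian ?g z *v a) \<le> 0"
    have "trace (orth_proj_matrix (E\<^sup>\<bottom>) ** hessian ?g z) = 1 * f z + (e - 1) * f z"
      unfolding hessian_lincomb[OF \<Omega>(1) sw sv z] trace_lincomb
        fiberwise_poisson_laplacian[OF E w z] fiberwise_poisson_laplacian[OF E v z] ..
    also have "\<dots> = e * f z" by (simp add: algebra_simps)
    finally show False using trace_orth_proj_nonpos[OF E H] f[OF z] e by (simp add: mult_le_0_iff)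
  qed
  then have "w x - v x \<le> e * \<bar>v x\<bar>"
    using mult_left_mono[OF abs_ge_minus_self[of "v x"], of e] e by (simp add: algebra_simps)
  also have "\<dots> \<le> (w x - v x) / 2"
  proof -
    have "e * \<bar>v x\<bar> \<le> e * (\<bar>v x\<bar> + 1)" using e by (simp add: mult_left_mono)
    also have "\<dots> = (w x - v x) / 2" by (simp add: e_def field_simps)
    finally show ?thesis .
  qed
  finally show False using c by (simp add: field_simps)
qed

text \<open>At an interior maximum of \<open>u - v\<close> the Hessian of \<open>v\<close> exceeds
  that of \<open>u\<close> by a positive semidefinite matrix, and \<open>msym_mono\<close>
  contradicts the strict inequality. The cone condition falls on \<open>u\<close>, the starting
  point of that monotonicity.\<close>

lemma msym_comparison:
  fixes \<Omega> :: "(real^'n::finite) set"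
  assumes \<Omega>: "open \<Omega>" "bounded \<Omega>" and k: "1 \<le> k" "k \<le> CARD('n)"
    and u: "smooth_up_to_boundary \<Omega> u" and v: "smooth_up_to_boundary \<Omega> v"
    and bd: "\<And>x. x \<in> frontier \<Omega> \<Longrightarrow> u x \<le> v x"
    and gu: "\<And>x. x \<in> \<Omega> \<Longrightarrow> garding k (hessian u x)"
    and lt: "\<And>x. x \<in> \<Omega> \<Longrightarrow> msym k (hessian v x) < msym k (hessian u x)"
    and x: "x \<in> \<Omega>"
  shows "u x \<le> v x"
proof -
  let ?g = "\<lambda>x. 1 * u x + (-1) * v x"
  have su: "smooth_on_open \<Omega> u" and sv: "smooth_on_open \<Omega> v"
    using u v by (auto simp: smooth_up_to_boundary_def)
  have "?g x \<le> 0"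
  proof (rule hessian_maximum_principle[OF \<Omega> _ _ _ x])
    show "smooth_up_to_boundary \<Omega> ?g" by (rule smooth_up_to_boundary_lincomb[OF \<Omega>(1) u v])
    show "?g z \<le> 0" if "z \<in> frontier \<Omega>" for z using bd[OF that] by simp
    fix z assume z: "z \<in> \<Omega>" and H: "\<And>a. a \<bullet> (hessian ?g z *v a) \<le> 0"
    define N where "N = hessian v z - hessian u z"
    have "hessian ?g z = - N" unfolding hessian_lincomb[OF \<Omega>(1) u v z] N_def by simp
    then have "a \<bullet> (N *v a) \<ge> 0" for a
      using H[of a] matrix_vector_mult_diff_rdistrib[of 0 N a] by simp
    moreover have "transpose N = N" "transpose (hessian u z) = hessian u z"
      unfolding N_def transpose_diff hessian_symmetric[OF \<Omega>(1) su z] hessian_symmetric[OF \<Omega>(1) sv z]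
      by simp_all
    ultimately have "msym k (hessian u z) \<le> msym k (hessian u z + N)"
      using msym_mono[OF _ _ _ gu[OF z] k] by blast
    then show False using lt[OF z] by (simp add: N_def)
  qed
  then show ?thesis by simp
qed

lemma admissible_solution_msym:
  fixes \<Omega> :: "(real^'n::finite) set"
  assumes \<Omega>: "open \<Omega>" and u: "admissible_solution k \<Omega> f g u" and x: "x \<in> \<Omega>"
  shows "garding k (hessian u x)" and "msym k (hessian u x) = f x"
proof -
  have "smooth_on_open \<Omega> u" using u by (simp add: admissible_solution_def smooth_up_to_boundary_def)
  then have "transpose (hessian u x) = hessian u x" by (rule hessian_symmetric[OF \<Omega> _ x])
  note eq = elem_sym_eigenvalues_eq_msym[OF this]
  show "garding k (hessian u x)"
    using u x by (auto simp: admissible_solution_def admissible_def Garding_cone_def garding_def eq)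
  show "msym k (hessian u x) = f x"
    using u x by (auto simp: admissible_solution_def sigma_def eq)
qed

section \<open>Barriers and the error estimate\<close>

lemma approx_error_bound:
  fixes \<Omega> E :: "(real^'n::finite) set"
  assumes k: "1 \<le> k" "k \<le> CARD('n)" and \<Omega>: "open \<Omega>" "bounded \<Omega>"
    and E: "subspace E" and dim: "dim E = k - 1"
    and c0: "c\<^sub>0 > 0" and f: "\<And>x. x \<in> \<Omega> \<Longrightarrow> c\<^sub>0 \<le> f x"
    and w: "fiberwise_poisson_correction \<Omega> E f w"
  obtains C t\<^sub>0 where "C > 0" "t\<^sub>0 > 0" "\<And>t u x. t \<ge> t\<^sub>0 \<Longrightarrow> admissible_solution k \<Omega> f (\<lambda>x. t * \<phi> E x) u \<Longrightarrow> x \<in> \<Omega> \<Longrightarrow>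
      \<bar>u x - approx_solution k E w t x\<bar> \<le> C * t powi (1 - 2 * int k)"
proof -
  have sw: "smooth_up_to_boundary \<Omega> w" and w0: "\<And>x. x \<in> frontier \<Omega> \<Longrightarrow> w x = 0"
    using w by (auto simp: fiberwise_poisson_correction_def)
  obtain K where K: "K \<ge> 0" "\<And>x i j. x \<in> \<Omega> \<Longrightarrow> \<bar>hessian w x $ i $ j\<bar> \<le> K" "\<And>x. x \<in> \<Omega> \<Longrightarrow> \<bar>w x\<bar> \<le> K"
    using smooth_up_to_boundary_hessian_bounded[OF \<Omega>(2) sw] by blast
  \<comment> \<open>Twice \<open>K\<close>, because the Hessian of \<open>w\<close> enters
    multiplied by some \<open>\<theta>\<close> between 0 and 2.\<close>
  have K2: "2 * K \<ge> 0" using K(1) by simp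
  obtain C where C: "C \<ge> 0" "\<And>\<epsilon> M. \<bar>\<epsilon>\<bar> \<le> 1 \<Longrightarrow> (\<And>i j. \<bar>M $ i $ j\<bar> \<le> 2 * K) \<Longrightarrow>
     \<bar>msym k (orth_proj_matrix E + \<epsilon> *\<^sub>R M) - \<epsilon> * trace (orth_proj_matrix (E\<^sup>\<bottom>) ** M)\<bar> \<le> C * \<epsilon>\<^sup>2"
    using msym_near_projection[OF E k(1) dim K2] by blast
  have "\<forall>j\<in>{1..k-1}. \<exists>\<epsilon>\<^sub>0>0. \<forall>\<epsilon> M. \<bar>\<epsilon>\<bar> \<le> \<epsilon>\<^sub>0 \<longrightarrow> (\<forall>i j. \<bar>M $ i $ j\<bar> \<le> 2 * K) \<longrightarrow> msym j (orth_proj_matrix E + \<epsilon> *\<^sub>R M) > 0"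
    using msym_pos_near_projection[OF E _ _ K2] dim by simp
  then obtain e where e: "\<And>j. j \<in> {1..k-1} \<Longrightarrow> e j > 0"
    "\<And>j \<epsilon> M. j \<in> {1..k-1} \<Longrightarrow> \<bar>\<epsilon>\<bar> \<le> e j \<Longrightarrow> (\<forall>i j. \<bar>M $ i $ j\<bar> \<le> 2 * K) \<Longrightarrow> msym j (orth_proj_matrix E + \<epsilon> *\<^sub>R M) > 0"
    unfolding bchoice_iff by blast
  \<comment> \<open>A common threshold for all \<open>j < k\<close>; the inserted 1 keeps the set
    nonempty when \<open>k = 1\<close>.\<close>
  define \<epsilon>\<^sub>0 where "\<epsilon>\<^sub>0 = Min (insert 1 (e ` {1..k-1}))"
  have e0: "\<epsilon>\<^sub>0 > 0" using e(1) by (simp add: \<epsilon>\<^sub>0_def)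
  have e0le: "\<epsilon>\<^sub>0 \<le> e j" if "j \<in> {1..k-1}" for j using that unfolding \<epsilon>\<^sub>0_def by (intro Min_le) auto
  \<comment> \<open>Makes \<open>A * f z \<ge> C + 1\<close>, so that the gain
    \<open>\<epsilon> * (A * f z)\<close> beats the expansion error
    \<open>C * \<epsilon>\<close>.\<close>
  define A where "A = (C + 1) / c\<^sub>0"
  have A: "A > 0" using C(1) c0 by (simp add: A_def)
  \<comment> \<open>Since \<open>\<epsilon> \<le> 1 / t\<close>, the three entries give
    \<open>\<epsilon> \<le> 1\<close>, \<open>A * \<epsilon> \<le> 1\<close> and
    \<open>\<epsilon> \<le> \<epsilon>\<^sub>0\<close>; the second keeps
    \<open>1 - A * \<epsilon>\<close> and \<open>1 + A * \<epsilon>\<close> in the range of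
    \<open>\<theta>\<close>.\<close>
  define t\<^sub>0 where "t\<^sub>0 = max 1 (max A (1 / \<epsilon>\<^sub>0))"
  show ?thesis
  \<comment> \<open>The added 1 keeps the constant positive when \<open>K = 0\<close>.\<close>
  proof (rule that[of "A * K + 1" t\<^sub>0])
    show "A * K + 1 > 0" using A K(1) by (simp add: add_nonneg_pos)
    show "t\<^sub>0 > 0" by (simp add: t\<^sub>0_def)
    fix t u x
    assume t: "t \<ge> t\<^sub>0" and u: "admissible_solution k \<Omega> f (\<lambda>x. t * \<phi> E x) u" and x: "x \<in> \<Omega>"
    have t1: "t \<ge> 1" "t \<ge> A" "t \<ge> 1 / \<epsilon>\<^sub>0" using t by (auto simp: t\<^sub>0_def)
    have su: "smooth_up_to_boundary \<Omega> u" and bu: "\<And>x. x \<in> frontier \<Omega> \<Longrightarrow> u x = t * \<phi> E x"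
      using u by (auto simp: admissible_solution_def)
    define \<epsilon> where "\<epsilon> = 1 / t ^ k"
    have tk: "t ^ k \<ge> t" using t1(1) k(1) by (metis power_increasing power_one_right)
    have eps: "\<epsilon> > 0" using t1 by (simp add: \<epsilon>_def)
    have "\<epsilon> \<le> 1 / t" unfolding \<epsilon>_def using tk t1 by (intro divide_left_mono) auto
    moreover have "1 / t \<le> 1" "1 / t \<le> \<epsilon>\<^sub>0" "A * (1 / t) \<le> 1"
      using t1 e0 by (simp_all add: divide_simps mult.commute)
    moreover have "A * \<epsilon> \<le> A * (1 / t)" using A \<open>\<epsilon> \<le> 1 / t\<close> by (intro mult_left_mono) auto
    ultimately have eps1: "\<epsilon> \<le> 1" "\<epsilon> \<le> \<epsilon>\<^sub>0" "A * \<epsilon> \<le> 1" by linarith+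
    have te: "t powi (1 - int k) = t * \<epsilon>"
      using t1 by (simp add: \<epsilon>_def power_int_diff)
    have tee: "t powi (1 - 2 * int k) = t * \<epsilon> * \<epsilon>"
    proof -
      have "t powi (1 - 2 * int k) = t powi ((1 - int k) + (- int k))" by (simp add: algebra_simps)
      also have "\<dots> = t powi (1 - int k) * t powi (- int k)" using t1 by (intro power_int_add) auto
      also have "t powi (- int k) = \<epsilon>" by (simp add: \<epsilon>_def power_int_minus divide_inverse)
      finally show ?thesis by (simp add: te)
    qed
    define W where "W \<theta> = (\<lambda>x. t * \<phi> E x + (\<theta> * t * \<epsilon>) * w x)" for \<theta>
    have sW: "smooth_up_to_boundary \<Omega> (W \<theta>)" for \<theta>
      unfolding W_def by (rule smooth_up_to_boundary_lincomb[OF \<Omega>(1) \<phi>_smooth[OF E] sw])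
    have bW: "W \<theta> z = u z" if "z \<in> frontier \<Omega>" for \<theta> z using that bu w0 by (simp add: W_def)
    have hW: "hessian (W \<theta>) z = t *\<^sub>R (orth_proj_matrix E + \<epsilon> *\<^sub>R (\<theta> *\<^sub>R hessian w z))" if "z \<in> \<Omega>" for \<theta> z
      unfolding W_def hessian_lincomb[OF \<Omega>(1) \<phi>_smooth[OF E] sw that] hessian_\<phi>[OF E]
      by (simp add: scaleR_add_right mult_ac)
    have ent: "\<bar>(\<theta> *\<^sub>R hessian w z) $ i $ j\<bar> \<le> 2 * K" if "z \<in> \<Omega>" "0 \<le> \<theta>" "\<theta> \<le> 2" for \<theta> z i j
      using mult_mono[OF that(3) K(2)[OF that(1), of i j]] that by (simp add: abs_mult)
    \<comment> \<open>Homogeneity of degree \<open>k\<close> multiplies the expansion by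
      \<open>t ^ k\<close>, the inverse of \<open>\<epsilon>\<close>: the first-order term becomes
      \<open>\<theta> * f z\<close>, and the error drops from \<open>C * \<epsilon>\<^sup>2\<close>
      to \<open>C * \<epsilon>\<close> in order.\<close>
    have est: "\<bar>msym k (hessian (W \<theta>) z) - \<theta> * f z\<bar> \<le> C * \<epsilon>" if z: "z \<in> \<Omega>" and th: "0 \<le> \<theta>" "\<theta> \<le> 2" for \<theta> z
    proof -
      define m where "m = msym k (orth_proj_matrix E + \<epsilon> *\<^sub>R (\<theta> *\<^sub>R hessian w z))"
      have tr: "trace (orth_proj_matrix (E\<^sup>\<bottom>) ** (\<theta> *\<^sub>R hessian w z)) = \<theta> * f z"
        using trace_lincomb[of "orth_proj_matrix (E\<^sup>\<bottom>)" \<theta> "hessian w z" 0 0] fiberwise_poisson_laplacian[OF E w z]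
        by simp
      have "\<bar>\<epsilon>\<bar> \<le> 1" using eps eps1 by simp
      from C(2)[OF this ent[OF z th]] have m: "\<bar>m - \<epsilon> * (\<theta> * f z)\<bar> \<le> C * \<epsilon>\<^sup>2" unfolding tr m_def .
      have "t ^ k * \<epsilon> = 1" using t1 by (simp add: \<epsilon>_def)
      then have "msym k (hessian (W \<theta>) z) - \<theta> * f z = t ^ k * (m - \<epsilon> * (\<theta> * f z))"
        unfolding hW[OF z] msym_scaleR m_def[symmetric] right_diff_distrib by (simp flip: mult.assoc)
      also have "\<bar>\<dots>\<bar> \<le> t ^ k * (C * \<epsilon>\<^sup>2)" using m t1 by (simp add: abs_mult mult_left_mono)
      also have "\<dots> = (t ^ k * \<epsilon>) * (C * \<epsilon>)" by (simp add: power2_eq_square mult_ac)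
      finally show ?thesis using \<open>t ^ k * \<epsilon> = 1\<close> by simp
    qed
    have Af: "A * f z \<ge> C + 1" if "z \<in> \<Omega>" for z
      using mult_left_mono[OF f[OF that], of A] A c0 by (simp add: A_def)
    have gap: "\<epsilon> * (A * f z) > C * \<epsilon>" if "z \<in> \<Omega>" for z
      using mult_strict_left_mono[of C "A * f z" \<epsilon>] Af[OF that] eps by (simp add: mult.commute)
    have up: "f z < msym k (hessian (W (1 + A * \<epsilon>)) z)" if z: "z \<in> \<Omega>" for z
    proof -
      have "\<bar>msym k (hessian (W (1 + A * \<epsilon>)) z) - (1 + A * \<epsilon>) * f z\<bar> \<le> C * \<epsilon>"
        using A eps eps1 by (intro est z) auto
      moreover have "(1 + A * \<epsilon>) * f z = f z + \<epsilon> * (A * f z)" by (simp add: algebra_simps)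
      ultimately show ?thesis using gap[OF z] by linarith
    qed
    have down: "msym k (hessian (W (1 - A * \<epsilon>)) z) < f z" if z: "z \<in> \<Omega>" for z
    proof -
      have "A * \<epsilon> \<ge> 0" using A eps by simp
      then have "\<bar>msym k (hessian (W (1 - A * \<epsilon>)) z) - (1 - A * \<epsilon>) * f z\<bar> \<le> C * \<epsilon>"
        using eps1 by (intro est z) linarith+
      moreover have "(1 - A * \<epsilon>) * f z = f z - \<epsilon> * (A * f z)" by (simp add: algebra_simps)
      ultimately show ?thesis using gap[OF z] by linarith
    qed
    \<comment> \<open>For \<open>j < k\<close> positivity is inherited from the nearby projection.
      At the projection itself \<open>\<sigma>\<^sub>k\<close> vanishes, so for \<open>j = k\<close>
      it has to come from \<open>up\<close>.\<close>
    have gW: "garding k (hessian (W (1 + A * \<epsilon>)) z)" if z: "z \<in> \<Omega>" for z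
      unfolding garding_def
    proof (intro allI impI)
      fix j assume j: "1 \<le> j \<and> j \<le> k"
      show "msym j (hessian (W (1 + A * \<epsilon>)) z) > 0"
      proof (cases "j = k")
        case True
        then show ?thesis using up[OF z] f[OF z] c0 by simp
      next
        case False
        then have j': "j \<in> {1..k-1}" using j by auto
        have "\<bar>\<epsilon>\<bar> \<le> e j" using eps eps1(2) e0le[OF j'] by simp
        moreover have "\<forall>i l. \<bar>((1 + A * \<epsilon>) *\<^sub>R hessian w z) $ i $ l\<bar> \<le> 2 * K"
          using A eps eps1 by (intro allI ent z) auto
        ultimately have "msym j (orth_proj_matrix E + \<epsilon> *\<^sub>R ((1 + A * \<epsilon>) *\<^sub>R hessian w z)) > 0"
          by (rule e(2)[OF j'])
        then show ?thesis unfolding hW[OF z] msym_scaleR using t1 by (intro mult_pos_pos) auto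
      qed
    qed
    \<comment> \<open>The larger multiple of \<open>w\<close> is the subsolution and so lies below.
      In \<open>lo\<close> the barrier carries the cone condition, in \<open>hi\<close> the solution
      \<open>u\<close> does.\<close>
    have lo: "W (1 + A * \<epsilon>) x \<le> u x"
      by (rule msym_comparison[OF \<Omega> k sW su _ gW _ x])
        (use bW up admissible_solution_msym(2)[OF \<Omega>(1) u] in auto)
    have hi: "u x \<le> W (1 - A * \<epsilon>) x"
      by (rule msym_comparison[OF \<Omega> k su sW _ _ _ x])
        (use bW down admissible_solution_msym[OF \<Omega>(1) u] in auto)
    have U: "approx_solution k E w t x = t * \<phi> E x + t * \<epsilon> * w x"
      by (simp add: approx_solution_def te)
    \<comment> \<open>The two barriers deviate from the approximation by
      \<open>A * \<epsilon> * (t * \<epsilon> * w x)\<close> with opposite signs.\<close>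
    have "\<bar>u x - approx_solution k E w t x\<bar> \<le> \<bar>A * \<epsilon> * (t * \<epsilon> * w x)\<bar>"
      using lo hi unfolding U W_def by (simp add: algebra_simps)
    also have "\<dots> = A * (t * \<epsilon> * \<epsilon>) * \<bar>w x\<bar>" using A eps t1 by (simp add: abs_mult)
    also have "\<dots> \<le> A * (t * \<epsilon> * \<epsilon>) * K" using A eps t1 K(3)[OF x] by (intro mult_left_mono) auto
    also have "\<dots> \<le> (A * K + 1) * (t * \<epsilon> * \<epsilon>)" using eps t1 by (simp add: algebra_simps)
    finally show "\<bar>u x - approx_solution k E w t x\<bar> \<le> (A * K + 1) * t powi (1 - 2 * int k)"
      by (simp only: tee)
  qed
qed

text \<open>Continuity supplies the measurability that the estimate of the essential supremum calls
  for.\<close>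

lemma Linfty_norm_le:
  assumes "open \<Omega>" and g: "continuous_on \<Omega> g" and le: "\<And>x. x \<in> \<Omega> \<Longrightarrow> \<bar>g x\<bar> \<le> c"
  shows "Linfty_norm \<Omega> g \<le> ereal c"
  unfolding Linfty_norm_def
proof (rule esssup_I)
  have "\<Omega> \<in> sets lebesgue" using assms(1) by (simp add: borel_open)
  then have "g \<in> borel_measurable (lebesgue_on \<Omega>)"
    by (intro continuous_imp_measurable_on_sets_lebesgue g)
  then show "(\<lambda>x. ereal \<bar>g x\<bar>) \<in> borel_measurable (restrict_space lebesgue \<Omega>)"
    by measurable
  show "AE x in restrict_space lebesgue \<Omega>. ereal \<bar>g x\<bar> \<le> ereal c"
    by (rule AE_I2) (use le in \<open>simp add: space_restrict_space\<close>)
qed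

text \<open>\<open>w\<close> and \<open>u\<close> are arbitrary functions with the defining
  properties, quantified after the constants, so that the constants depend on the data
  alone.\<close>

theorem proposition4p3:
  fixes \<Omega> E :: "(real^'n::finite) set" and f :: "real^'n \<Rightarrow> real" and k :: nat and c\<^sub>0 :: real
  assumes "2 \<le> k" and "k \<le> CARD('n)"
    and "bounded \<Omega>" and "smooth_domain \<Omega>" and "uniformly_convex \<Omega>"
    and "E \<in> Grassmannian (k - 1)"
    and "smooth_up_to_boundary \<Omega> f" and "c\<^sub>0 > 0" and "\<forall>x\<in>closure \<Omega>. c\<^sub>0 \<le> f x"
  shows "(\<forall>w t. fiberwise_poisson_correction \<Omega> E f w \<longrightarrow> t > 0 \<longrightarrow>
            smooth_up_to_boundary \<Omega> (approx_solution k E w t) \<and>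
            (\<forall>x\<in>frontier \<Omega>. approx_solution k E w t x = t * \<phi> E x) \<and>
            (\<forall>u. admissible_solution k \<Omega> f (\<lambda>x. t * \<phi> E x) u \<longrightarrow>
                 smooth_up_to_boundary \<Omega> (\<lambda>x. u x - approx_solution k E w t x))) \<and>
         (\<exists>C>0. \<exists>t\<^sub>0>0. \<forall>w t u.
            fiberwise_poisson_correction \<Omega> E f w \<longrightarrow> t \<ge> t\<^sub>0 \<longrightarrow>
            admissible_solution k \<Omega> f (\<lambda>x. t * \<phi> E x) u \<longrightarrow>
            Linfty_norm \<Omega> (\<lambda>x. u x - approx_solution k E w t x)
              \<le> ereal (C * t powi (1 - 2 * int k)))"
proof -
  have op: "open \<Omega>" using assms(4) by (simp add: smooth_domain_def)
  have E: "subspace E" "dim E = k - 1" using assms(6) by (auto simp: Grassmannian_def)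
  have f: "c\<^sub>0 \<le> f x" if "x \<in> \<Omega>" for x using assms(9) that closure_subset by blast
  have smooth: "smooth_up_to_boundary \<Omega> (approx_solution k E w t)"
    if "fiberwise_poisson_correction \<Omega> E f w" for w t
    using smooth_up_to_boundary_lincomb[OF op \<phi>_smooth[OF E(1)]] that
    unfolding approx_solution_def[abs_def] by (simp add: fiberwise_poisson_correction_def)
  have smooth_diff: "smooth_up_to_boundary \<Omega> (\<lambda>x. u x - approx_solution k E w t x)"
    if "fiberwise_poisson_correction \<Omega> E f w" "admissible_solution k \<Omega> f g u" for w t u g
    using smooth_up_to_boundary_lincomb[OF op _ smooth[OF that(1)], of u 1 "-1"] that(2)
    by (simp add: admissible_solution_def)
  have "\<exists>C>0. \<exists>t\<^sub>0>0. \<forall>w t u. fiberwise_poisson_correction \<Omega> E f w \<longrightarrow> t \<ge> t\<^sub>0 \<longrightarrow>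
            admissible_solution k \<Omega> f (\<lambda>x. t * \<phi> E x) u \<longrightarrow>
            Linfty_norm \<Omega> (\<lambda>x. u x - approx_solution k E w t x) \<le> ereal (C * t powi (1 - 2 * int k))"
  \<comment> \<open>The constants are extracted from one correction; if there is none, the bound
    holds vacuously.\<close>
  proof (cases "\<exists>w. fiberwise_poisson_correction \<Omega> E f w")
    case True
    then obtain w where w: "fiberwise_poisson_correction \<Omega> E f w" ..
    have k1: "1 \<le> k" using assms(1) by simp
    obtain C t\<^sub>0 where C: "C > 0" "t\<^sub>0 > 0" "\<And>t u x. t \<ge> t\<^sub>0 \<Longrightarrow> admissible_solution k \<Omega> f (\<lambda>x. t * \<phi> E x) u \<Longrightarrow> x \<in> \<Omega> \<Longrightarrow>
      \<bar>u x - approx_solution k E w t x\<bar> \<le> C * t powi (1 - 2 * int k)"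
      using approx_error_bound[OF k1 assms(2) op assms(3) E assms(8) f w] by blast
    have "Linfty_norm \<Omega> (\<lambda>x. u x - approx_solution k E v t x) \<le> ereal (C * t powi (1 - 2 * int k))"
      if v: "fiberwise_poisson_correction \<Omega> E f v" and t: "t \<ge> t\<^sub>0"
        and u: "admissible_solution k \<Omega> f (\<lambda>x. t * \<phi> E x) u" for v t u
    proof (rule Linfty_norm_le[OF op])
      show "continuous_on \<Omega> (\<lambda>x. u x - approx_solution k E v t x)"
        by (rule continuous_on_subset[OF _ closure_subset],
            rule smooth_diff[OF v u, of t, unfolded smooth_up_to_boundary_def, THEN conjunct2, THEN conjunct1])
      fix x assume x: "x \<in> \<Omega>"
      have fpos: "f z > 0" if "z \<in> \<Omega>" for z using f[OF that] assms(8) by linarith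
      \<comment> \<open>Uniqueness of the correction on \<open>\<Omega>\<close> transfers the
        estimate from \<open>w\<close> to \<open>v\<close>.\<close>
      have "w x = v x"
        using fiberwise_poisson_le[OF op assms(3) E(1) fpos w v x]
          fiberwise_poisson_le[OF op assms(3) E(1) fpos v w x] by (rule order_antisym)
      then show "\<bar>u x - approx_solution k E v t x\<bar> \<le> C * t powi (1 - 2 * int k)"
        using C(3)[OF t u x] by (simp add: approx_solution_def)
    qed
    then show ?thesis using C(1,2) by blast
  qed (use zero_less_one in blast)
  moreover have "approx_solution k E w t x = t * \<phi> E x"
    if "fiberwise_poisson_correction \<Omega> E f w" "x \<in> frontier \<Omega>" for w t x
    using that by (simp add: approx_solution_def fiberwise_poisson_correction_def)
  ultimately show ?thesis using smooth smooth_diff by blast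
qed

end
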